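(* Let $n\ge 2$, $b\in\mathbb{R}^{n^2}$, $\lambda>0$, $\mu_1>0$, $\mu_2>0$, and let $D\in\mathbb{R}^{(n^2-n)\times n^2}$, $P\in\mathbb{R}^{n^2\times n^2}$ and the soft-thresholding operator $\mathcal{T}$ be as defined in the context. Consider the constrained form of the anisotropic total variation denoising problem $$\min_{d_x,d_y,u,v}\ \lambda(\|d_x\|_1+\|d_y\|_1)+\tfrac12\|u-b\|^2\quad\text{s.t.}\quad d_x=Du,\ \ d_y=Dv,\ \ v=Pu, \qquad (\ast)$$ with $d_x,d_y\in\mathbb{R}^{n^2-n}$ and $u,v\in\mathbb{R}^{n^2}$. Starting from arbitrary $u^{0}\in\mathbb{R}^{n^2}$, $d_y^{0}\in\mathbb{R}^{n^2-n}$, $\gamma_x^0,\gamma_y^0\in\mathbb{R}^{n^2-n}$, $\gamma_z^0\in\mathbb{R}^{n^2}$, define for $k=0,1,2,\dots$ successively: 1. $d_x^{k+1}=\mathcal{T}(Du^k+\mu_1\gamma_x^k,\ \lambda\mu_1)$; 2. $v^{k+1}$ is the unique solution of $\left(D^TD+\frac{\mu_1}{\mu_2}I\right)v=D^T(d_y^k-\mu_1\gamma_y^k)+\mu_1\gamma_z^k+\frac{\mu_1}{\mu_2}Pu^k$; 3. $d_y^{k+1}=\mathcal{T}(Dv^{k+1}+\mu_1\gamma_y^k,\ \lambda\mu_1)$; 4. $u^{k+1}$ is the unique solution of $\left(D^TD+\left(\frac{\mu_1}{\mu_2}+\mu_1\right)I\right)u=\mu_1 b+D^T(d_x^{k+1}-\mu_1\gamma_x^k)+P^T\left(\frac{\mu_1}{\mu_2}v^{k+1}-\mu_1\gamma_z^k\right)$;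 5. $\gamma_x^{k+1}=\gamma_x^k+\frac1{\mu_1}(Du^{k+1}-d_x^{k+1})$, $\ \gamma_y^{k+1}=\gamma_y^k+\frac1{\mu_1}(Dv^{k+1}-d_y^{k+1})$, $\ \gamma_z^{k+1}=\gamma_z^k+\frac1{\mu_2}(Pu^{k+1}-v^{k+1})$. Then the sequence $\big((d_x^k,d_y^k,u^k,v^k),(\gamma_x^k,\gamma_y^k,\gamma_z^k)\big)_{k\ge1}$ converges to a primal-dual optimal solution pair of problem $(\ast)$.
   Context: $\|\cdot\|$ is the Euclidean norm and $\|\cdot\|_1$ the $\ell_1$-norm. An $n\times n$ image $U=(U_{ij})$ is identified with the column-major vector $u\in\mathbb{R}^{n^2}$, $u_{i+(j-1)n}=U_{ij}$, $1\le i,j\le n$. The matrix $D\in\mathbb{R}^{(n^2-n)\times n^2}$ is block diagonal with $n$ identical diagonal blocks, each of size $(n-1)\times n$ and upper bidiagonal with $-1$'s on the diagonal and $1$'s on the super-diagonal. The matrix $P$ is the $n^2\times n^2$ permutation matrix such that $Pu$ is the row-major vectorization of the image: $(Pu)_{j+(i-1)n}=u_{i+(j-1)n}$. The soft-thresholding operator is defined componentwise, for a vector $x$ and a scalar $t>0$, by $\mathcal{T}(x,t)_i=\max\{|x_i|-t,0\}\,\mathrm{sign}(x_i)$. A primal-dual optimal solution pair of $(\ast)$ is a pair $\big((d_x^*,d_y^*,u^*,v^* ),(\gamma_x^*,\gamma_y^*,\gamma_z^* )\big)$ such that $(d_x^*,d_y^*,u^*,v^* )$ is an optimal solution of $(\ast)$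 and minimizes over all $(d_x,d_y,u,v)$ the Lagrangian $$\lambda(\|d_x\|_1+\|d_y\|_1)+\tfrac12\|u-b\|^2+(\gamma_x^{*})^{T}(Du-d_x)+(\gamma_y^{*})^{T}(Dv-d_y)+(\gamma_z^{*})^{T}(Pu-v).$$ *)

theory Defs
  imports Complex_Main "Jordan_Normal_Form.Matrix"
begin

text \<open>Vectors and matrices are those of Jordan_Normal_Form, whose indices start at 0. An
  n by n image U is the vector u of dimension n^2 with u $ (i + j * n) = U i j for i, j < n.\<close>

definition l2_norm :: "real vec \<Rightarrow> real" where
  "l2_norm x = sqrt (\<Sum>i<dim_vec x. (x $ i)\<^sup>2)"

definition l1_norm :: "real vec \<Rightarrow> real" where
  "l1_norm x = (\<Sum>i<dim_vec x. \<bar>x $ i\<bar>)"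

definition vec_converges :: "nat \<Rightarrow> (nat \<Rightarrow> real vec) \<Rightarrow> real vec \<Rightarrow> bool" where
  "vec_converges m X L \<longleftrightarrow>
     (\<forall>k. X k \<in> carrier_vec m) \<and> L \<in> carrier_vec m \<and>
     (\<lambda>k. l2_norm (X k - L)) \<longlonglongrightarrow> 0"

definition diff_block :: "nat \<Rightarrow> real mat" where
  "diff_block n = mat (n - 1) n (\<lambda>(i, j). if j = i then - 1 else if j = Suc i then 1 else 0)"

definition diff_mat :: "nat \<Rightarrow> real mat" where
  "diff_mat n = diag_block_mat (replicate n (diff_block n))"

text \<open>Row r = j + i * n (with i = r div n and j = r mod n) picks entry i + j * n.\<close>

definition row_major_mat :: "nat \<Rightarrow> real mat" where
  "row_major_mat n =
     mat (n\<^sup>2) (n\<^sup>2) (\<lambda>(r, c). if c = r div n + (r mod n) * n then 1 else 0)"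

definition soft_threshold :: "real vec \<Rightarrow> real \<Rightarrow> real vec" where
  "soft_threshold x t = vec (dim_vec x) (\<lambda>i. max (\<bar>x $ i\<bar> - t) 0 * sgn (x $ i))"

lemma diff_mat_carrier: "diff_mat n \<in> carrier_mat (n\<^sup>2 - n) (n\<^sup>2)"
  by (intro carrier_matI)
     (simp_all add: diff_mat_def diff_block_def dim_diag_block_mat sum_list_replicate
        power2_eq_square diff_mult_distrib2)

lemma row_major_mat_mult:
  assumes u: "u \<in> carrier_vec (n\<^sup>2)" and i: "i < n" and j: "j < n"
  shows "(row_major_mat n *\<^sub>v u) $ (j + i * n) = u $ (i + j * n)"
proof -
  have lt: "a + b * n < n\<^sup>2" if "a < n" "b < n" for a b
  proof -
    have "a + b * n < Suc b * n" using that by simp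
    also have "\<dots> \<le> n * n" using that by (intro mult_right_mono) auto
    finally show ?thesis by (simp add: power2_eq_square)
  qed
  have "(row_major_mat n *\<^sub>v u) $ (j + i * n)
        = (\<Sum>c = 0..<n\<^sup>2. (if c = i + j * n then 1 else 0) * u $ c)"
    using u i j lt[OF j i] by (simp add: row_major_mat_def scalar_prod_def)
  also have "\<dots> = (\<Sum>c = 0..<n\<^sup>2. if c = i + j * n then u $ c else 0)"
    by (intro sum.cong) auto
  also have "\<dots> = u $ (i + j * n)"
    using lt[OF i j] by simp
  finally show ?thesis .
qed

definition tv_objective ::
  "real \<Rightarrow> real vec \<Rightarrow> real vec \<Rightarrow> real vec \<Rightarrow> real vec \<Rightarrow> real vec \<Rightarrow> real" where
  "tv_objective lam b dx dy u v = lam * (l1_norm dx + l1_norm dy) + 1/2 * (l2_norm (u - b))\<^sup>2"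

definition tv_vars :: "nat \<Rightarrow> real vec \<Rightarrow> real vec \<Rightarrow> real vec \<Rightarrow> real vec \<Rightarrow> bool" where
  "tv_vars n dx dy u v \<longleftrightarrow>
     dx \<in> carrier_vec (n\<^sup>2 - n) \<and> dy \<in> carrier_vec (n\<^sup>2 - n) \<and>
     u \<in> carrier_vec (n\<^sup>2) \<and> v \<in> carrier_vec (n\<^sup>2)"

definition tv_feasible :: "nat \<Rightarrow> real vec \<Rightarrow> real vec \<Rightarrow> real vec \<Rightarrow> real vec \<Rightarrow> bool" where
  "tv_feasible n dx dy u v \<longleftrightarrow>
     tv_vars n dx dy u v \<and>
     dx = diff_mat n *\<^sub>v u \<and> dy = diff_mat n *\<^sub>v v \<and> v = row_major_mat n *\<^sub>v u"

definition tv_optimal ::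
  "nat \<Rightarrow> real \<Rightarrow> real vec \<Rightarrow> real vec \<Rightarrow> real vec \<Rightarrow> real vec \<Rightarrow> real vec \<Rightarrow> bool" where
  "tv_optimal n lam b dx dy u v \<longleftrightarrow>
     tv_feasible n dx dy u v \<and>
     (\<forall>dx' dy' u' v'. tv_feasible n dx' dy' u' v' \<longrightarrow>
        tv_objective lam b dx dy u v \<le> tv_objective lam b dx' dy' u' v')"

definition tv_lagrangian ::
  "nat \<Rightarrow> real \<Rightarrow> real vec \<Rightarrow> real vec \<Rightarrow> real vec \<Rightarrow> real vec \<Rightarrow>
   real vec \<Rightarrow> real vec \<Rightarrow> real vec \<Rightarrow> real vec \<Rightarrow> real" where
  "tv_lagrangian n lam b \<gamma>x \<gamma>y \<gamma>z dx dy u v =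
     tv_objective lam b dx dy u v
     + \<gamma>x \<bullet> (diff_mat n *\<^sub>v u - dx)
     + \<gamma>y \<bullet> (diff_mat n *\<^sub>v v - dy)
     + \<gamma>z \<bullet> (row_major_mat n *\<^sub>v u - v)"

definition tv_primal_dual_optimal ::
  "nat \<Rightarrow> real \<Rightarrow> real vec \<Rightarrow> real vec \<Rightarrow> real vec \<Rightarrow> real vec \<Rightarrow> real vec \<Rightarrow>
   real vec \<Rightarrow> real vec \<Rightarrow> real vec \<Rightarrow> bool" where
  "tv_primal_dual_optimal n lam b dx dy u v \<gamma>x \<gamma>y \<gamma>z \<longleftrightarrow>
     tv_optimal n lam b dx dy u v \<and>
     \<gamma>x \<in> carrier_vec (n\<^sup>2 - n) \<and> \<gamma>y \<in> carrier_vec (n\<^sup>2 - n) \<and> \<gamma>z \<in> carrier_vec (n\<^sup>2) \<and>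
     (\<forall>dx' dy' u' v'. tv_vars n dx' dy' u' v' \<longrightarrow>
        tv_lagrangian n lam b \<gamma>x \<gamma>y \<gamma>z dx dy u v
          \<le> tv_lagrangian n lam b \<gamma>x \<gamma>y \<gamma>z dx' dy' u' v')"

end

theory Submission
  imports Defs "Jordan_Normal_Form.Determinant"
begin

text \<open>The iteration is ADMM for the two blocks \<open>(d\<^sub>x, v)\<close> and \<open>(d\<^sub>y, u)\<close>. Measured from any KKT
  point, the energy
  \<open>\<mu>\<^sub>1 (\<bar>\<gamma>\<^sub>x\<bar>\<^sup>2 + \<bar>\<gamma>\<^sub>y\<bar>\<^sup>2) + \<mu>\<^sub>2 \<bar>\<gamma>\<^sub>z\<bar>\<^sup>2 + (\<bar>D u\<bar>\<^sup>2 + \<bar>d\<^sub>y\<bar>\<^sup>2) / \<mu>\<^sub>1 + \<bar>P u\<bar>\<^sup>2 / \<mu>\<^sub>2\<close>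
  decreases in each step by at least the energy of the increment plus twice the squared error of
  \<open>u\<close>. Hence \<open>u\<close> and, through the multiplier updates, all primal variables converge. The
  multipliers are bounded, so they have a cluster point; it is again part of a KKT point, and the
  energy measured from that point decreases and has a subsequence tending to 0. A KKT point
  exists because the dual problem, a least-squares problem over a box, attains its minimum.\<close>

section \<open>Bounded least squares and subgradients of the absolute value\<close>

text \<open>The energy sees only \<open>D u\<close>, \<open>P u\<close> and \<open>d\<^sub>y\<close>
  because these second-block quantities, with the multipliers, are all that one step hands to the
  next; its weights come from the penalties \<open>1 / \<mu>1\<close> and \<open>1 / \<mu>2\<close>
  of the constraints. The first block is computed from the old second block, so its optimality
  conditions hold at the new multipliers only up to a difference of consecutive iterates; those of
  the second block hold exactly. Hence the second-block conditions of two consecutive iterates can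
  be subtracted, and this cancels the cross terms in the energy balance. The arbitrary starting data
  need not satisfy them, so descent begins at index 1. The squared error of \<open>u\<close> stems
  from the strong convexity of the fidelity term. It drives \<open>u\<close> to the \<open>u\<close>
  component of every KKT point; all KKT points thus share their primal part, and a cluster point of
  the multipliers can be paired with a primal limit already known. For the dual, stationarity in
  \<open>v\<close> and \<open>u\<close> eliminates \<open>\<gamma>\<^sub>z\<close> and expresses
  \<open>u\<close> as \<open>b\<close> minus a linear image of
  \<open>(\<gamma>\<^sub>x, \<gamma>\<^sub>y)\<close>; the l1 terms contribute the box of radius
  \<open>lam\<close>.\<close>

lemma finite_bounded_imp_convergent_subseq:
  fixes X :: "nat \<Rightarrow> 'i \<Rightarrow> real"
  assumes "finite I" and "\<And>i. i \<in> I \<Longrightarrow> Bseq (\<lambda>k. X k i)"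
  shows "\<exists>r :: nat \<Rightarrow> nat. strict_mono r \<and> (\<exists>L. \<forall>i\<in>I. (\<lambda>k. X (r k) i) \<longlonglongrightarrow> L i)"
  using assms
proof (induction I rule: finite_induct)
  case empty
  show ?case by (auto intro!: exI[of _ id] strict_monoI)
next
  case (insert j I)
  then obtain r :: "nat \<Rightarrow> nat" and L where r: "strict_mono r"
    and L: "\<forall>i\<in>I. (\<lambda>k. X (r k) i) \<longlonglongrightarrow> L i"
    by blast
  obtain s :: "nat \<Rightarrow> nat" where s: "strict_mono s"
    and mono: "monoseq (\<lambda>k. X (r (s k)) j)"
    using seq_monosub[of "\<lambda>k. X (r k) j"] by auto
  have "Bseq (\<lambda>k. X (r (s k)) j)"
    using Bseq_subseq[of "\<lambda>k. X k j" "r \<circ> s"] insert.prems by (simp add: o_def)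
  then obtain l where l: "(\<lambda>k. X (r (s k)) j) \<longlonglongrightarrow> l"
    using Bseq_monoseq_convergent[OF _ mono] by (auto simp: convergent_def)
  have "(\<lambda>k. X ((r \<circ> s) k) i) \<longlonglongrightarrow> (L(j := l)) i" if "i \<in> insert j I" for i
  proof (cases "i = j")
    case True
    then show ?thesis using l by simp
  next
    case False
    then have "(\<lambda>k. X (r k) i) \<longlonglongrightarrow> L i" using that L by auto
    from LIMSEQ_subseq_LIMSEQ[OF this s] False show ?thesis by (simp add: o_def)
  qed
  then show ?case
    using strict_mono_o[OF r s] by blast
qed

text \<open>Direct method: a minimizing sequence has a subsequence converging in the coordinates
  from \<open>I\<close>, and only these enter the box and the objective.\<close>

lemma box_least_squares_minimizer:
  fixes K :: "'i \<Rightarrow> 'j \<Rightarrow> real" and b :: "'j \<Rightarrow> real"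
  assumes "finite I" and "lam \<ge> 0"
  shows "\<exists>g. (\<forall>i\<in>I. \<bar>g i\<bar> \<le> lam) \<and>
    (\<forall>h. (\<forall>i\<in>I. \<bar>h i\<bar> \<le> lam) \<longrightarrow>
      (\<Sum>j\<in>J. (b j - (\<Sum>i\<in>I. K i j * g i))\<^sup>2) \<le> (\<Sum>j\<in>J. (b j - (\<Sum>i\<in>I. K i j * h i))\<^sup>2))"
proof -
  define F where "F g = (\<Sum>j\<in>J. (b j - (\<Sum>i\<in>I. K i j * g i))\<^sup>2)" for g
  define B where "B = {g. \<forall>i\<in>I. \<bar>g i\<bar> \<le> lam}"
  define m where "m = Inf (F ` B)"
  have ne: "F ` B \<noteq> {}" using assms(2) by (auto simp: B_def intro: exI[of _ "\<lambda>_. 0"])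
  have bdd: "bdd_below (F ` B)"
    by (rule bdd_belowI[of _ 0]) (auto simp: F_def sum_nonneg)
  have "\<exists>g\<in>B. F g < m + 1 / real (Suc k)" for k
    using cInf_lessD[OF ne, of "m + 1 / real (Suc k)"] by (auto simp: m_def)
  then obtain X where X: "\<And>k. X k \<in> B" and FX: "\<And>k. F (X k) < m + 1 / real (Suc k)"
    by metis
  have "Bseq (\<lambda>k. X k i)" if "i \<in> I" for i
    using X that by (intro BseqI'[of _ lam]) (auto simp: B_def)
  from finite_bounded_imp_convergent_subseq[where X = X, OF assms(1) this]
  obtain r :: "nat \<Rightarrow> nat" and g where r: "strict_mono r"
    and g: "\<And>i. i \<in> I \<Longrightarrow> (\<lambda>k. X (r k) i) \<longlonglongrightarrow> g i"
    by auto
  have gB: "g \<in> B"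
    unfolding B_def
  proof clarify
    fix i assume i: "i \<in> I"
    show "\<bar>g i\<bar> \<le> lam"
      by (rule tendsto_upperbound[OF tendsto_rabs[OF g[OF i]]])
        (use X i in \<open>auto simp: B_def\<close>)
  qed
  have 1: "(\<lambda>k. F (X (r k))) \<longlonglongrightarrow> F g"
    unfolding F_def by (intro tendsto_intros g)
  have 2: "(\<lambda>k. m + 1 / real (Suc k)) \<longlonglongrightarrow> m"
    using tendsto_add[OF tendsto_const[of m] LIMSEQ_Suc[OF lim_1_over_n]] by simp
  have 3: "(\<lambda>k. m + 1 / real (Suc (r k))) \<longlonglongrightarrow> m"
    using LIMSEQ_subseq_LIMSEQ[OF 2 r] by (simp add: o_def)
  have "F g \<le> m"
    using FX by (intro LIMSEQ_le[OF 1 3]) (auto intro: less_imp_le)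
  then have "F g \<le> F h" if "h \<in> B" for h
    using cInf_lower[OF _ bdd, of "F h"] that by (simp add: m_def)
  with gB show ?thesis
    unfolding F_def B_def by blast
qed

section \<open>Subgradients of the absolute value\<close>

text \<open>Equality in the Fenchel inequality. It has two readings: \<open>g\<close> is a
  subgradient of \<open>lam\<close> times the absolute value at \<open>x\<close>, which is what
  soft-thresholding yields, and \<open>x\<close> is normal to the interval of radius
  \<open>lam\<close> at \<open>g\<close>, which is what the dual problem yields.\<close>

definition abs_subgradient :: "real \<Rightarrow> real \<Rightarrow> real \<Rightarrow> bool" where
  "abs_subgradient lam g x \<longleftrightarrow> \<bar>g\<bar> \<le> lam \<and> g * x = lam * \<bar>x\<bar>"

text \<open>The bound on \<open>g\<close> gives \<open>g * y \<le> lam * \<bar>y\<bar>\<close> for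
  every \<open>y\<close>, with equality at \<open>x\<close>: the left side is 0 and the right side
  nonnegative.\<close>

lemma abs_subgradientD:
  assumes "abs_subgradient lam g x"
  shows "lam * \<bar>x\<bar> - g * x \<le> lam * \<bar>y\<bar> - g * y"
proof -
  have "g * y \<le> \<bar>g\<bar> * \<bar>y\<bar>" by (metis abs_ge_self abs_mult)
  also have "\<dots> \<le> lam * \<bar>y\<bar>" using assms by (intro mult_right_mono) (auto simp: abs_subgradient_def)
  finally show ?thesis using assms by (simp add: abs_subgradient_def)
qed

lemma abs_subgradient_mono:
  assumes "abs_subgradient lam g x" and "abs_subgradient lam h y"
  shows "(g - h) * (x - y) \<ge> 0"
  using abs_subgradientD[OF assms(1), of y] abs_subgradientD[OF assms(2), of x]
  by (simp add: algebra_simps)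

lemma abs_subgradient_lim:
  assumes "\<And>k. abs_subgradient lam (g k) (x k)"
    and g: "g \<longlonglongrightarrow> g'" and x: "x \<longlonglongrightarrow> x'"
  shows "abs_subgradient lam g' x'"
proof -
  have "\<bar>g'\<bar> \<le> lam"
    by (rule tendsto_upperbound[OF tendsto_rabs[OF g]])
      (use assms(1) in \<open>auto simp: abs_subgradient_def\<close>)
  moreover have "(\<lambda>k. g k * x k) \<longlonglongrightarrow> g' * x'"
    by (intro tendsto_intros g x)
  moreover have "(\<lambda>k. g k * x k) \<longlonglongrightarrow> lam * \<bar>x'\<bar>"
    using assms(1) tendsto_mult[OF tendsto_const tendsto_rabs[OF x], of lam]
    by (simp add: abs_subgradient_def)
  ultimately show ?thesis
    using LIMSEQ_unique by (auto simp: abs_subgradient_def)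
qed

text \<open>Soft-thresholding is the proximal map of \<open>t\<close> times the absolute value, and
  this is its optimality condition.\<close>

lemma soft_threshold_abs_subgradient:
  fixes x t :: real
  assumes "t \<ge> 0" and y: "y = max (\<bar>x\<bar> - t) 0 * sgn x"
  shows "abs_subgradient t (x - y) y"
  using assms(1) unfolding y abs_subgradient_def
  by (auto simp: max_def sgn_if abs_if algebra_simps)

lemma abs_subgradient_scale:
  assumes "c > 0" and "abs_subgradient (lam * c) (c * g) x"
  shows "abs_subgradient lam g x"
proof -
  have "c * \<bar>g\<bar> \<le> c * lam" "c * (g * x) = c * (lam * \<bar>x\<bar>)"
    using assms by (auto simp: abs_subgradient_def abs_mult mult_ac)
  then show ?thesis using assms(1) by (simp add: abs_subgradient_def)
qed

text \<open>The dual of total variation denoising is a least-squares problem over a box. Moving a single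
  coordinate of its minimizer towards \<open>lam * sgn c\<close>, where \<open>c\<close> is the corresponding
  coordinate of the residual's image, yields the subgradient condition.\<close>

lemma box_dual_exists:
  fixes K :: "'i \<Rightarrow> 'j \<Rightarrow> real" and b :: "'j \<Rightarrow> real"
  assumes I: "finite I" and J: "finite J" and lam: "lam \<ge> 0"
  shows "\<exists>g. \<forall>i\<in>I. abs_subgradient lam (g i)
    (\<Sum>j\<in>J. K i j * (b j - (\<Sum>i'\<in>I. K i' j * g i')))"
proof -
  obtain g where gB: "\<And>i. i \<in> I \<Longrightarrow> \<bar>g i\<bar> \<le> lam"
    and gmin: "\<And>h. (\<forall>i\<in>I. \<bar>h i\<bar> \<le> lam) \<Longrightarrow>
      (\<Sum>j\<in>J. (b j - (\<Sum>i\<in>I. K i j * g i))\<^sup>2) \<le> (\<Sum>j\<in>J. (b j - (\<Sum>i\<in>I. K i j * h i))\<^sup>2)"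
    using box_least_squares_minimizer[OF I lam, where J = J and b = b and K = K] by blast
  define u where "u j = b j - (\<Sum>i\<in>I. K i j * g i)" for j
  have "abs_subgradient lam (g i) (\<Sum>j\<in>J. K i j * u j)" if i: "i \<in> I" for i
  proof -
    define c where "c = (\<Sum>j\<in>J. K i j * u j)"
    define \<kappa> where "\<kappa> = (\<Sum>j\<in>J. (K i j)\<^sup>2)"
    \<comment> \<open>The product \<open>w * c = lam * \<bar>c\<bar> - g i * c\<close> is exactly
      the defect in the subgradient condition, so it suffices to show that it vanishes.\<close>
    define w where "w = lam * sgn c - g i"
    have "0 \<le> w * c"
    proof -
      have "g i * c \<le> \<bar>g i\<bar> * \<bar>c\<bar>" by (metis abs_ge_self abs_mult)
      also have "\<dots> \<le> lam * \<bar>c\<bar>" using gB[OF i] by (intro mult_right_mono) auto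
      finally show ?thesis by (simp add: w_def algebra_simps abs_sgn)
    qed
    \<comment> \<open>The step \<open>s * w\<close> gives a convex combination of points of the box.
      It changes the objective by \<open>- 2 * s * w * c + s\<^sup>2 * w\<^sup>2 * \<kappa>\<close>,
      which minimality makes nonnegative; dividing by \<open>s\<close> gives the claim.\<close>
    have ineq: "2 * (w * c) \<le> s * (w\<^sup>2 * \<kappa>)" if s: "0 < s" "s \<le> 1" for s
    proof -
      define h where "h = g(i := g i + s * w)"
      have "\<bar>h i'\<bar> \<le> lam" if "i' \<in> I" for i'
      proof (cases "i' = i")
        case True
        have "g i + s * w = (1 - s) * g i + s * (lam * sgn c)"
          by (simp add: w_def algebra_simps)
        also have "\<bar>\<dots>\<bar> \<le> (1 - s) * \<bar>g i\<bar> + s * (lam * \<bar>sgn c\<bar>)"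
          using abs_triangle_ineq[of "(1 - s) * g i" "s * (lam * sgn c)"] s lam
          by (simp add: abs_mult)
        also have "\<dots> \<le> (1 - s) * lam + s * (lam * 1)"
          using s lam gB[OF i] by (intro add_mono mult_left_mono) (auto simp: abs_sgn_eq)
        finally show ?thesis using True by (simp add: h_def algebra_simps)
      next
        case False
        then show ?thesis using gB that by (simp add: h_def)
      qed
      then have "(\<Sum>j\<in>J. (u j)\<^sup>2) \<le> (\<Sum>j\<in>J. (b j - (\<Sum>i\<in>I. K i j * h i))\<^sup>2)"
        using gmin[of h] by (simp add: u_def)
      also have "\<dots> = (\<Sum>j\<in>J. (u j - s * w * K i j)\<^sup>2)"
      proof (intro sum.cong refl)
        fix j
        have "(\<Sum>i\<in>I. K i j * h i) = (\<Sum>i\<in>I. K i j * g i) + s * w * K i j"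
          using I i by (simp add: sum.remove[OF I i] h_def algebra_simps)
        then show "(b j - (\<Sum>i\<in>I. K i j * h i))\<^sup>2 = (u j - s * w * K i j)\<^sup>2"
          by (simp add: u_def algebra_simps)
      qed
      also have "\<dots> = (\<Sum>j\<in>J. (u j)\<^sup>2) - 2 * s * w * c + s\<^sup>2 * w\<^sup>2 * \<kappa>"
        unfolding c_def \<kappa>_def sum_distrib_left sum_subtractf[symmetric] sum.distrib[symmetric]
        by (intro sum.cong) (auto simp: power2_eq_square algebra_simps)
      finally have "s * (2 * (w * c)) \<le> s * (s * (w\<^sup>2 * \<kappa>))"
        by (simp add: power2_eq_square mult_ac)
      then show ?thesis using s by simp
    qed
    have "w * c = 0"
    proof (rule ccontr)
      assume "w * c \<noteq> 0"
      with \<open>0 \<le> w * c\<close> have pos: "0 < w * c" by linarith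
      \<comment> \<open>Chosen to make the right side of \<open>ineq\<close> at most
        \<open>w * c\<close>, against \<open>2 * (w * c)\<close> on the left; the \<open>+ 1\<close>
        avoids a zero denominator.\<close>
      define s where "s = min 1 (w * c / (w\<^sup>2 * \<kappa> + 1))"
      have k0: "0 \<le> w\<^sup>2 * \<kappa>" by (simp add: \<kappa>_def sum_nonneg)
      have s: "0 < s" "s \<le> 1" using pos k0 by (auto simp: s_def intro!: divide_pos_pos)
      have "2 * (w * c) \<le> s * (w\<^sup>2 * \<kappa>)" by (rule ineq[OF s])
      also have "\<dots> \<le> s * (w\<^sup>2 * \<kappa> + 1)" using s by simp
      also have "\<dots> \<le> w * c / (w\<^sup>2 * \<kappa> + 1) * (w\<^sup>2 * \<kappa> + 1)"
        using k0 by (intro mult_right_mono) (auto simp: s_def)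
      also have "\<dots> = w * c" using k0 by simp
      finally show False using pos by linarith
    qed
    then have "g i * c = lam * \<bar>c\<bar>"
      by (auto simp: w_def algebra_simps abs_sgn)
    then show ?thesis using gB[OF i] by (simp add: abs_subgradient_def c_def)
  qed
  then show ?thesis unfolding u_def by blast
qed

section \<open>Matrices and componentwise limits\<close>

lemma scalar_prod_eq_sum:
  assumes "y \<in> carrier_vec m"
  shows "x \<bullet> y = (\<Sum>i<m. x $ i * y $ i)"
  using assms by (auto simp: scalar_prod_def atLeast0LessThan)

text \<open>The quadratic form of \<open>A\<close> at \<open>v\<close> is the squared norm of
  \<open>D v\<close> plus \<open>c\<close> times that of \<open>v\<close>. So the kernel is trivial
  whatever the rank of \<open>D\<close>, and a square matrix with trivial kernel is
  invertible.\<close>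

lemma transpose_gram_plus_scaled_one_ex1:
  fixes D :: "real mat"
  assumes D: "D \<in> carrier_mat M N" and c: "c > 0"
    and A: "A = D\<^sup>T * D + c \<cdot>\<^sub>m 1\<^sub>m N"
    and r: "r \<in> carrier_vec N"
  shows "\<exists>!x. x \<in> carrier_vec N \<and> A *\<^sub>v x = r"
proof -
  have Ac: "A \<in> carrier_mat N N" using D A by auto
  have ker: "v = 0\<^sub>v N" if v: "v \<in> carrier_vec N" and Av: "A *\<^sub>v v = 0\<^sub>v N" for v
  proof -
    have Dv: "D *\<^sub>v v \<in> carrier_vec M" using D v by simp
    have eq: "A *\<^sub>v v = D\<^sup>T *\<^sub>v (D *\<^sub>v v) + c \<cdot>\<^sub>v v"
      unfolding A using D v
      by (subst add_mult_distrib_mat_vec[of _ N N]) (auto simp: assoc_mult_mat_vec[of _ N M _ N])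
    have "(D\<^sup>T *\<^sub>v (D *\<^sub>v v)) \<bullet> v = (D *\<^sub>v v) \<bullet> (D *\<^sub>v v)"
      using transpose_vec_mult_scalar[OF D v Dv] D v Dv
      by (simp add: comm_scalar_prod[of _ N])
    moreover have "(A *\<^sub>v v) \<bullet> v = (D\<^sup>T *\<^sub>v (D *\<^sub>v v)) \<bullet> v + c * (v \<bullet> v)"
      unfolding eq using D v by (subst add_scalar_prod_distrib[of _ N]) auto
    ultimately have "(D *\<^sub>v v) \<bullet> (D *\<^sub>v v) + c * (v \<bullet> v) = 0"
      using Av v by simp
    then have "(\<Sum>i<M. ((D *\<^sub>v v) $ i)\<^sup>2) + c * (\<Sum>i<N. (v $ i)\<^sup>2) = 0"
      using scalar_prod_eq_sum[OF Dv, of "D *\<^sub>v v"] scalar_prod_eq_sum[OF v, of v]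
      by (simp add: power2_eq_square)
    moreover have "0 \<le> (\<Sum>i<M. ((D *\<^sub>v v) $ i)\<^sup>2)" "0 \<le> c * (\<Sum>i<N. (v $ i)\<^sup>2)"
      using c by (auto intro!: sum_nonneg mult_nonneg_nonneg)
    ultimately have "c * (\<Sum>i<N. (v $ i)\<^sup>2) = 0" by linarith
    then have "(\<Sum>i<N. (v $ i)\<^sup>2) = 0" using c by simp
    then have "\<forall>i<N. v $ i = 0" by (simp add: sum_nonneg_eq_0_iff)
    then show ?thesis using v by (intro eq_vecI) auto
  qed
  then have "det A \<noteq> 0" using det_0_iff_vec_prod_zero_field[OF Ac] by auto
  from det_non_zero_imp_unit[OF Ac this, unfolded Units_def, of "()"]
  obtain B where B: "B \<in> carrier_mat N N" and AB: "A * B = 1\<^sub>m N"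
    by (auto simp: ring_mat_def)
  show ?thesis
  proof (rule ex1I[of _ "B *\<^sub>v r"])
    show "B *\<^sub>v r \<in> carrier_vec N \<and> A *\<^sub>v (B *\<^sub>v r) = r"
      using assoc_mult_mat_vec[OF Ac B r] AB B r by auto
  next
    fix x assume x: "x \<in> carrier_vec N \<and> A *\<^sub>v x = r"
    have "A *\<^sub>v (x - B *\<^sub>v r) = r - r"
      using x assoc_mult_mat_vec[OF Ac B r] AB B r
      by (subst mult_minus_distrib_mat_vec[OF Ac]) auto
    then have "x - B *\<^sub>v r = 0\<^sub>v N" using ker[of "x - B *\<^sub>v r"] x B r by auto
    then have "\<forall>i<N. (x - B *\<^sub>v r) $ i = 0" by simp
    then show "x = B *\<^sub>v r"
      using x B r by (intro eq_vecI) auto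
  qed
qed

lemma row_major_mat_carrier: "row_major_mat n \<in> carrier_mat (n\<^sup>2) (n\<^sup>2)"
  by (simp add: row_major_mat_def)

text \<open>The index map \<open>\<sigma>\<close> transposes the image and is therefore an
  involution, so column \<open>i\<close> has its single 1 in row \<open>\<sigma> i\<close>, and
  distinct columns have it in distinct rows.\<close>

lemma row_major_mat_orthogonal: "(row_major_mat n)\<^sup>T * row_major_mat n = 1\<^sub>m (n\<^sup>2)"
proof (cases "n = 0")
  case True
  then show ?thesis by (intro eq_matI) (auto simp: row_major_mat_def)
next
  case False
  define \<sigma> where "\<sigma> r = r div n + (r mod n) * n" for r
  have \<sigma>_less: "\<sigma> r < n\<^sup>2" if "r < n\<^sup>2" for r
  proof -
    have "r div n < n" using that by (simp add: power2_eq_square less_mult_imp_div_less)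
    moreover have "r mod n < n" using False by simp
    ultimately have "\<sigma> r < Suc (r mod n) * n" by (simp add: \<sigma>_def)
    also have "\<dots> \<le> n * n" using \<open>r mod n < n\<close> by (intro mult_right_mono) auto
    finally show ?thesis by (simp add: power2_eq_square)
  qed
  have \<sigma>_\<sigma>: "\<sigma> (\<sigma> r) = r" if "r < n\<^sup>2" for r
  proof -
    have "r div n < n" using that by (simp add: power2_eq_square less_mult_imp_div_less)
    then have "\<sigma> r div n = r mod n" "\<sigma> r mod n = r div n" by (auto simp: \<sigma>_def)
    then have "\<sigma> (\<sigma> r) = r mod n + r div n * n" by (simp add: \<sigma>_def)
    then show ?thesis by simp
  qed
  show ?thesis
  proof (intro eq_matI)
    fix i j assume "i < dim_row (1\<^sub>m (n\<^sup>2) :: real mat)" "j < dim_col (1\<^sub>m (n\<^sup>2) :: real mat)"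
    then have ij: "i < n\<^sup>2" "j < n\<^sup>2" by auto
    have "((row_major_mat n)\<^sup>T * row_major_mat n) $$ (i, j)
        = (\<Sum>r<n\<^sup>2. (if i = \<sigma> r then 1 else 0) * (if j = \<sigma> r then 1 else 0))"
      using ij by (simp add: row_major_mat_def scalar_prod_def \<sigma>_def atLeast0LessThan)
    also have "\<dots> = (\<Sum>r<n\<^sup>2. if r = \<sigma> i then (if i = j then 1 else 0) else 0)"
      using \<sigma>_\<sigma> \<sigma>_less ij by (intro sum.cong) auto
    also have "\<dots> = (1\<^sub>m (n\<^sup>2) :: real mat) $$ (i, j)"
      using \<sigma>_less[OF ij(1)] ij by simp
    finally show "((row_major_mat n)\<^sup>T * row_major_mat n) $$ (i, j) = (1\<^sub>m (n\<^sup>2) :: real mat) $$ (i, j)" .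
  qed (auto simp: row_major_mat_def)
qed

lemma mult_mat_vec_eq_sum:
  assumes "A \<in> carrier_mat m n" and "x \<in> carrier_vec n" and "i < m"
  shows "(A *\<^sub>v x) $ i = (\<Sum>j<n. A $$ (i, j) * x $ j)"
  using assms by (simp add: scalar_prod_eq_sum[of x n])

lemma sum_mult_mat_vec_adjoint:
  fixes A :: "real mat"
  assumes A: "A \<in> carrier_mat m n" and x: "x \<in> carrier_vec n" and y: "y \<in> carrier_vec m"
  shows "(\<Sum>i<m. y $ i * (A *\<^sub>v x) $ i) = (\<Sum>j<n. (A\<^sup>T *\<^sub>v y) $ j * x $ j)"
  using transpose_vec_mult_scalar[OF A x y] A x
  by (simp add: scalar_prod_eq_sum[of _ m] scalar_prod_eq_sum[of _ n])

lemma tendsto_mult_mat_vec: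
  fixes A :: "real mat"
  assumes A: "A \<in> carrier_mat m n" and X: "\<And>k. X k \<in> carrier_vec n" and L: "L \<in> carrier_vec n"
    and lim: "\<And>j. j < n \<Longrightarrow> (\<lambda>k. X k $ j) \<longlonglongrightarrow> L $ j" and i: "i < m"
  shows "(\<lambda>k. (A *\<^sub>v X k) $ i) \<longlonglongrightarrow> (A *\<^sub>v L) $ i"
  unfolding mult_mat_vec_eq_sum[OF A X i] mult_mat_vec_eq_sum[OF A L i]
  by (intro tendsto_intros lim) auto

lemma vec_convergesI:
  assumes X: "\<And>k. X k \<in> carrier_vec m" and L: "L \<in> carrier_vec m"
    and lim: "\<And>j. j < m \<Longrightarrow> (\<lambda>k. X k $ j) \<longlonglongrightarrow> L $ j"
  shows "vec_converges m X L"
proof -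
  have "(\<lambda>k. sqrt (\<Sum>i<m. (X k $ i - L $ i)\<^sup>2)) \<longlonglongrightarrow> sqrt (\<Sum>i<m. (L $ i - L $ i)\<^sup>2)"
    by (intro tendsto_intros lim) auto
  moreover have "l2_norm (X k - L) = sqrt (\<Sum>i<m. (X k $ i - L $ i)\<^sup>2)" for k
    using L by (simp add: l2_norm_def)
  ultimately show ?thesis
    using X L by (simp add: vec_converges_def)
qed

lemma sum_mult_mat_vec_adjoint_diff:
  fixes A :: "real mat"
  assumes A: "A \<in> carrier_mat m n" and x: "x \<in> carrier_vec n" "x' \<in> carrier_vec n"
    and y: "y \<in> carrier_vec m" "y' \<in> carrier_vec m"
  shows "(\<Sum>i<m. (y $ i - y' $ i) * ((A *\<^sub>v x) $ i - (A *\<^sub>v x') $ i))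
    = (\<Sum>j<n. ((A\<^sup>T *\<^sub>v y) $ j - (A\<^sup>T *\<^sub>v y') $ j) * (x $ j - x' $ j))"
proof -
  have AT: "A\<^sup>T \<in> carrier_mat n m" using A by simp
  have "(\<Sum>i<m. (y - y') $ i * (A *\<^sub>v (x - x')) $ i) = (\<Sum>j<n. (A\<^sup>T *\<^sub>v (y - y')) $ j * (x - x') $ j)"
    by (rule sum_mult_mat_vec_adjoint[OF A]) (use x y in auto)
  then show ?thesis
    unfolding mult_minus_distrib_mat_vec[OF A x] mult_minus_distrib_mat_vec[OF AT y]
    using A x y by (simp del: index_mult_mat_vec)
qed

lemma descent_imp_tendsto_0:
  fixes V E :: "nat \<Rightarrow> real"
  assumes "\<And>k. V (Suc k) + E k \<le> V k" and "\<And>k. 0 \<le> V k" and "\<And>k. 0 \<le> E k"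
  shows "E \<longlonglongrightarrow> 0"
proof -
  have "V (Suc k) \<le> V k" for k using assms(1,3)[of k] by linarith
  then have "decseq V" by (intro decseq_SucI)
  then obtain L where L: "V \<longlonglongrightarrow> L"
    using decseq_convergent[of V 0] assms(2) by blast
  have "(\<lambda>k. V k - V (Suc k)) \<longlonglongrightarrow> L - L"
    by (intro tendsto_diff L LIMSEQ_Suc)
  then have "(\<lambda>k. V k - V (Suc k)) \<longlonglongrightarrow> 0" by simp
  then show ?thesis
    by (rule real_tendsto_sandwich[OF _ _ tendsto_const, rotated 2])
      (use assms in \<open>auto simp: algebra_simps\<close>)
qed

lemma tendsto_0_of_square_le:
  fixes x E :: "nat \<Rightarrow> real"
  assumes "c > 0" and "\<And>k. c * (x k)\<^sup>2 \<le> E k" and E: "E \<longlonglongrightarrow> 0"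
  shows "x \<longlonglongrightarrow> 0"
proof -
  have "(\<lambda>k. E k / c) \<longlonglongrightarrow> 0" using tendsto_divide[OF E tendsto_const, of c] assms(1) by simp
  then have "(\<lambda>k. (x k)\<^sup>2) \<longlonglongrightarrow> 0"
    by (rule real_tendsto_sandwich[OF _ _ tendsto_const, rotated 2])
      (use assms(1,2) in \<open>auto simp: field_simps\<close>)
  from tendsto_real_sqrt[OF this] show ?thesis
    by (simp add: tendsto_rabs_zero_iff)
qed

lemma decseq_subseq_tendsto_0:
  fixes V :: "nat \<Rightarrow> real"
  assumes "decseq V" and "\<And>k. 0 \<le> V k" and "strict_mono r" and "(\<lambda>k. V (r k)) \<longlonglongrightarrow> 0"
  shows "V \<longlonglongrightarrow> 0"
proof -
  obtain L where L: "V \<longlonglongrightarrow> L" using decseq_convergent[of V 0] assms(1,2) by blast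
  from LIMSEQ_subseq_LIMSEQ[OF L assms(3)] have "(\<lambda>k. V (r k)) \<longlonglongrightarrow> L" by (simp add: o_def)
  with assms(4) have "L = 0" using LIMSEQ_unique by blast
  with L show ?thesis by simp
qed

section \<open>KKT points of the denoising problem\<close>

locale denoising =
  fixes M N :: nat and D P :: "real mat" and b :: "real vec" and lam :: real
  assumes D: "D \<in> carrier_mat M N" and P: "P \<in> carrier_mat N N" and P_orth: "P\<^sup>T * P = 1\<^sub>m N"
    and b: "b \<in> carrier_vec N" and lam: "lam > 0"
begin

text \<open>Feasibility together with stationarity of the Lagrangian:
  \<open>\<gamma>z = D\<^sup>T *\<^sub>v \<gamma>y\<close> is the condition in \<open>v\<close>, the
  componentwise equation the one in \<open>u\<close>, and the subgradient conditions are those in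
  \<open>dx\<close> and \<open>dy\<close>.\<close>

definition kkt :: "real vec \<Rightarrow> real vec \<Rightarrow> real vec \<Rightarrow> real vec \<Rightarrow> real vec \<Rightarrow> real vec \<Rightarrow> real vec \<Rightarrow> bool"
  where "kkt dx dy u v \<gamma>x \<gamma>y \<gamma>z \<longleftrightarrow>
    u \<in> carrier_vec N \<and> \<gamma>x \<in> carrier_vec M \<and> \<gamma>y \<in> carrier_vec M \<and>
    dx = D *\<^sub>v u \<and> v = P *\<^sub>v u \<and> dy = D *\<^sub>v v \<and> \<gamma>z = D\<^sup>T *\<^sub>v \<gamma>y \<and>
    (\<forall>j<N. u $ j + (D\<^sup>T *\<^sub>v \<gamma>x) $ j + (P\<^sup>T *\<^sub>v \<gamma>z) $ j = b $ j) \<and>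
    (\<forall>i<M. abs_subgradient lam (\<gamma>x $ i) (dx $ i)) \<and>
    (\<forall>i<M. abs_subgradient lam (\<gamma>y $ i) (dy $ i))"

lemma kkt_carrier:
  assumes "kkt dx dy u v \<gamma>x \<gamma>y \<gamma>z"
  shows "dx \<in> carrier_vec M" "dy \<in> carrier_vec M" "u \<in> carrier_vec N" "v \<in> carrier_vec N"
    "\<gamma>x \<in> carrier_vec M" "\<gamma>y \<in> carrier_vec M" "\<gamma>z \<in> carrier_vec N"
  using assms D P by (auto simp: kkt_def)

text \<open>With \<open>\<gamma>z\<close> eliminated, the rows of \<open>D\<close> act on
  \<open>\<gamma>x\<close> and those of \<open>D * P\<close> on \<open>\<gamma>y\<close>. Stacking
  them over a disjoint sum gives one matrix \<open>K\<close>, and the residual of the dual minimizer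
  is the primal \<open>u\<close>.\<close>

lemma kkt_exists: "\<exists>dx dy u v \<gamma>x \<gamma>y \<gamma>z. kkt dx dy u v \<gamma>x \<gamma>y \<gamma>z"
proof -
  have DP: "D * P \<in> carrier_mat M N" using D P by simp
  define K where "K = case_sum (\<lambda>i j. D $$ (i, j)) (\<lambda>i j. (D * P) $$ (i, j))"
  define I where "I = {..<M} <+> {..<M}"
  obtain g where g: "\<And>i. i \<in> I \<Longrightarrow> abs_subgradient lam (g i)
      (\<Sum>j<N. K i j * (b $ j - (\<Sum>i'\<in>I. K i' j * g i')))"
    using box_dual_exists[of I "{..<N}" lam K "\<lambda>j. b $ j"] lam by (auto simp: I_def)
  define \<gamma>x where "\<gamma>x = vec M (\<lambda>i. g (Inl i))"
  define \<gamma>y where "\<gamma>y = vec M (\<lambda>i. g (Inr i))"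
  define \<gamma>z where "\<gamma>z = D\<^sup>T *\<^sub>v \<gamma>y"
  define u where "u = vec N (\<lambda>j. b $ j - (\<Sum>i\<in>I. K i j * g i))"
  have carr: "\<gamma>x \<in> carrier_vec M" "\<gamma>y \<in> carrier_vec M" "u \<in> carrier_vec N"
    by (auto simp: \<gamma>x_def \<gamma>y_def u_def)
  have z: "P\<^sup>T *\<^sub>v \<gamma>z = (D * P)\<^sup>T *\<^sub>v \<gamma>y"
    unfolding \<gamma>z_def transpose_mult[OF D P]
    using D P carr by (subst assoc_mult_mat_vec[of _ N N _ M]) auto
  have stat: "u $ j + (D\<^sup>T *\<^sub>v \<gamma>x) $ j + (P\<^sup>T *\<^sub>v \<gamma>z) $ j = b $ j" if j: "j < N" for j
  proof -
    have "(D\<^sup>T *\<^sub>v \<gamma>x) $ j = (\<Sum>i<M. D $$ (i, j) * g (Inl i))"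
      using D j carr by (subst mult_mat_vec_eq_sum[of _ N M]) (auto simp: \<gamma>x_def)
    moreover have "(P\<^sup>T *\<^sub>v \<gamma>z) $ j = (\<Sum>i<M. (D * P) $$ (i, j) * g (Inr i))"
      unfolding z using DP D P j carr
      by (subst mult_mat_vec_eq_sum[of _ N M]) (auto simp: \<gamma>y_def)
    ultimately show ?thesis
      using j by (simp add: u_def I_def sum.Plus K_def)
  qed
  have x: "abs_subgradient lam (\<gamma>x $ i) ((D *\<^sub>v u) $ i)" if i: "i < M" for i
    using g[of "Inl i"] i unfolding mult_mat_vec_eq_sum[OF D carr(3) i]
    by (simp add: I_def K_def u_def \<gamma>x_def InlI)
  have y: "abs_subgradient lam (\<gamma>y $ i) ((D *\<^sub>v (P *\<^sub>v u)) $ i)" if i: "i < M" for i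
    using g[of "Inr i"] i
    unfolding assoc_mult_mat_vec[OF D P carr(3), symmetric] mult_mat_vec_eq_sum[OF DP carr(3) i]
    by (simp add: I_def K_def u_def \<gamma>y_def InrI del: index_mult_mat)
  have "kkt (D *\<^sub>v u) (D *\<^sub>v (P *\<^sub>v u)) u (P *\<^sub>v u) \<gamma>x \<gamma>y \<gamma>z"
    unfolding kkt_def using carr stat x y by (auto simp: \<gamma>z_def)
  then show ?thesis by blast
qed

end

section \<open>Sufficiency of the KKT conditions\<close>

text \<open>The relation between \<open>\<gamma>z\<close> and \<open>\<gamma>y\<close> cancels all
  terms in \<open>v\<close>; after moving \<open>D\<close> and \<open>P\<close> to the multipliers,
  what remains separates by coordinates and can be minimized term by term.\<close>

lemma tv_lagrangian_eq_sum:
  fixes n defines "M \<equiv> n\<^sup>2 - n" and "N \<equiv> n\<^sup>2" and "D \<equiv> diff_mat n" and "P \<equiv> row_major_mat n"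
  assumes b: "b \<in> carrier_vec N"
    and \<gamma>: "\<gamma>x \<in> carrier_vec M" "\<gamma>y \<in> carrier_vec M" "\<gamma>z = D\<^sup>T *\<^sub>v \<gamma>y"
    and vars: "tv_vars n dx dy u v"
  shows "tv_lagrangian n lam b \<gamma>x \<gamma>y \<gamma>z dx dy u v =
    (\<Sum>i<M. lam * \<bar>dx $ i\<bar> - \<gamma>x $ i * dx $ i) + (\<Sum>i<M. lam * \<bar>dy $ i\<bar> - \<gamma>y $ i * dy $ i)
    + (\<Sum>j<N. 1/2 * (u $ j - b $ j)\<^sup>2 + ((D\<^sup>T *\<^sub>v \<gamma>x) $ j + (P\<^sup>T *\<^sub>v \<gamma>z) $ j) * u $ j)"
proof -
  have D: "D \<in> carrier_mat M N" and P: "P \<in> carrier_mat N N"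
    using diff_mat_carrier row_major_mat_carrier by (auto simp: D_def P_def M_def N_def)
  have c: "dx \<in> carrier_vec M" "dy \<in> carrier_vec M" "u \<in> carrier_vec N" "v \<in> carrier_vec N"
    using vars by (auto simp: tv_vars_def M_def N_def)
  have \<gamma>z: "\<gamma>z \<in> carrier_vec N" using \<gamma> D by simp
  have "\<gamma>x \<bullet> (D *\<^sub>v u - dx) = (\<Sum>i<M. \<gamma>x $ i * (D *\<^sub>v u) $ i) - (\<Sum>i<M. \<gamma>x $ i * dx $ i)"
    using D c by (simp add: scalar_prod_eq_sum[of _ M] right_diff_distrib sum_subtractf
      del: index_mult_mat_vec)
  also have "(\<Sum>i<M. \<gamma>x $ i * (D *\<^sub>v u) $ i) = (\<Sum>j<N. (D\<^sup>T *\<^sub>v \<gamma>x) $ j * u $ j)"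
    by (rule sum_mult_mat_vec_adjoint[OF D c(3) \<gamma>(1)])
  finally have 1: "\<gamma>x \<bullet> (D *\<^sub>v u - dx) =
    (\<Sum>j<N. (D\<^sup>T *\<^sub>v \<gamma>x) $ j * u $ j) - (\<Sum>i<M. \<gamma>x $ i * dx $ i)" .
  have "\<gamma>y \<bullet> (D *\<^sub>v v - dy) = (\<Sum>i<M. \<gamma>y $ i * (D *\<^sub>v v) $ i) - (\<Sum>i<M. \<gamma>y $ i * dy $ i)"
    using D c by (simp add: scalar_prod_eq_sum[of _ M] right_diff_distrib sum_subtractf
      del: index_mult_mat_vec)
  also have "(\<Sum>i<M. \<gamma>y $ i * (D *\<^sub>v v) $ i) = (\<Sum>j<N. \<gamma>z $ j * v $ j)"
    unfolding \<gamma>(3) by (rule sum_mult_mat_vec_adjoint[OF D c(4) \<gamma>(2)])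
  finally have 2: "\<gamma>y \<bullet> (D *\<^sub>v v - dy) =
    (\<Sum>j<N. \<gamma>z $ j * v $ j) - (\<Sum>i<M. \<gamma>y $ i * dy $ i)" .
  have "\<gamma>z \<bullet> (P *\<^sub>v u - v) = (\<Sum>i<N. \<gamma>z $ i * (P *\<^sub>v u) $ i) - (\<Sum>j<N. \<gamma>z $ j * v $ j)"
    using P c by (simp add: scalar_prod_eq_sum[of _ N] right_diff_distrib sum_subtractf
      del: index_mult_mat_vec)
  also have "(\<Sum>i<N. \<gamma>z $ i * (P *\<^sub>v u) $ i) = (\<Sum>j<N. (P\<^sup>T *\<^sub>v \<gamma>z) $ j * u $ j)"
    by (rule sum_mult_mat_vec_adjoint[OF P c(3) \<gamma>z])
  finally have 3: "\<gamma>z \<bullet> (P *\<^sub>v u - v) =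
    (\<Sum>j<N. (P\<^sup>T *\<^sub>v \<gamma>z) $ j * u $ j) - (\<Sum>j<N. \<gamma>z $ j * v $ j)" .
  have 4: "tv_objective lam b dx dy u v =
    (\<Sum>i<M. lam * \<bar>dx $ i\<bar>) + (\<Sum>i<M. lam * \<bar>dy $ i\<bar>) + (\<Sum>j<N. 1/2 * (u $ j - b $ j)\<^sup>2)"
    using b c by (simp add: tv_objective_def l1_norm_def l2_norm_def sum_nonneg
        sum_distrib_left distrib_left)
  show ?thesis
    unfolding tv_lagrangian_def D_def[symmetric] P_def[symmetric] 1 2 3 4
    by (simp add: sum.distrib sum_subtractf distrib_right)
qed

lemma kkt_imp_primal_dual_optimal:
  assumes b: "b \<in> carrier_vec (n\<^sup>2)" and lam: "lam > 0"
    and kkt: "denoising.kkt (n\<^sup>2 - n) (n\<^sup>2) (diff_mat n) (row_major_mat n) b lam dx dy u v \<gamma>x \<gamma>y \<gamma>z"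
  shows "tv_primal_dual_optimal n lam b dx dy u v \<gamma>x \<gamma>y \<gamma>z"
proof -
  interpret denoising "n\<^sup>2 - n" "n\<^sup>2" "diff_mat n" "row_major_mat n" b lam
    using assms by unfold_locales
      (auto simp: diff_mat_carrier row_major_mat_carrier row_major_mat_orthogonal)
  note c = kkt_carrier[OF kkt]
  have vars: "tv_vars n dx dy u v" using c by (simp add: tv_vars_def)
  then have feas: "tv_feasible n dx dy u v"
    using kkt unfolding tv_feasible_def kkt_def by blast
  have \<gamma>z: "\<gamma>z = (diff_mat n)\<^sup>T *\<^sub>v \<gamma>y" using kkt by (simp add: kkt_def)
  have le: "tv_lagrangian n lam b \<gamma>x \<gamma>y \<gamma>z dx dy u v \<le> tv_lagrangian n lam b \<gamma>x \<gamma>y \<gamma>z dx' dy' u' v'"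
    if vars': "tv_vars n dx' dy' u' v'" for dx' dy' u' v'
    unfolding tv_lagrangian_eq_sum[OF b c(5,6) \<gamma>z vars] tv_lagrangian_eq_sum[OF b c(5,6) \<gamma>z vars']
  proof (rule add_mono[OF add_mono[OF sum_mono sum_mono] sum_mono])
    fix i assume "i \<in> {..<n\<^sup>2 - n}"
    then show "lam * \<bar>dx $ i\<bar> - \<gamma>x $ i * dx $ i \<le> lam * \<bar>dx' $ i\<bar> - \<gamma>x $ i * dx' $ i"
      using kkt by (intro abs_subgradientD) (auto simp: kkt_def)
  next
    fix i assume "i \<in> {..<n\<^sup>2 - n}"
    then show "lam * \<bar>dy $ i\<bar> - \<gamma>y $ i * dy $ i \<le> lam * \<bar>dy' $ i\<bar> - \<gamma>y $ i * dy' $ i"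
      using kkt by (intro abs_subgradientD) (auto simp: kkt_def)
  next
    fix j assume "j \<in> {..<n\<^sup>2}"
    define p where "p = ((diff_mat n)\<^sup>T *\<^sub>v \<gamma>x) $ j + ((row_major_mat n)\<^sup>T *\<^sub>v \<gamma>z) $ j"
    have "b $ j = u $ j + p"
      using kkt \<open>j \<in> _\<close> by (auto simp: kkt_def p_def)
    \<comment> \<open>Stationarity places the vertex of this parabola at \<open>u $ j\<close>, so
      only the square of the displacement is left.\<close>
    then have "1/2 * (u' $ j - b $ j)\<^sup>2 + p * u' $ j - (1/2 * (u $ j - b $ j)\<^sup>2 + p * u $ j)
        = 1/2 * (u' $ j - u $ j)\<^sup>2"
      by (simp add: power2_eq_square field_simps)
    then show "1/2 * (u $ j - b $ j)\<^sup>2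
        + (((diff_mat n)\<^sup>T *\<^sub>v \<gamma>x) $ j + ((row_major_mat n)\<^sup>T *\<^sub>v \<gamma>z) $ j) * u $ j
      \<le> 1/2 * (u' $ j - b $ j)\<^sup>2
        + (((diff_mat n)\<^sup>T *\<^sub>v \<gamma>x) $ j + ((row_major_mat n)\<^sup>T *\<^sub>v \<gamma>z) $ j) * u' $ j"
      using zero_le_power2[of "u' $ j - u $ j"] unfolding p_def[symmetric] by argo
  qed
  \<comment> \<open>The multiplier terms vanish on feasible points, so minimality of the Lagrangian
    over all points restricts to optimality for the constrained problem.\<close>
  have feas_lagr: "tv_lagrangian n lam b \<gamma>x \<gamma>y \<gamma>z dx' dy' u' v' = tv_objective lam b dx' dy' u' v'"
    if "tv_feasible n dx' dy' u' v'" for dx' dy' u' v'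
  proof -
    have "dx' \<in> carrier_vec (n\<^sup>2 - n)" "dy' \<in> carrier_vec (n\<^sup>2 - n)" "v' \<in> carrier_vec (n\<^sup>2)"
      and eqs: "diff_mat n *\<^sub>v u' = dx'" "diff_mat n *\<^sub>v v' = dy'" "row_major_mat n *\<^sub>v u' = v'"
      using that by (auto simp: tv_feasible_def tv_vars_def)
    then show ?thesis
      unfolding tv_lagrangian_def eqs using c by simp
  qed
  have "tv_optimal n lam b dx dy u v"
    unfolding tv_optimal_def
    using feas le feas_lagr by (metis tv_feasible_def)
  then show ?thesis
    unfolding tv_primal_dual_optimal_def using c le by blast
qed

section \<open>The energy estimate\<close>

text \<open>The arguments \<open>g, h, k, a, y, q\<close> stand for errors of
  \<open>\<gamma>\<^sub>x, \<gamma>\<^sub>y, \<gamma>\<^sub>z, D u, d\<^sub>y, P u\<close>.\<close>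

definition admm_energy :: "nat \<Rightarrow> nat \<Rightarrow> real \<Rightarrow> real \<Rightarrow> (nat \<Rightarrow> real) \<Rightarrow> (nat \<Rightarrow> real) \<Rightarrow> (nat \<Rightarrow> real) \<Rightarrow>
    (nat \<Rightarrow> real) \<Rightarrow> (nat \<Rightarrow> real) \<Rightarrow> (nat \<Rightarrow> real) \<Rightarrow> real"
  where "admm_energy M N \<mu>1 \<mu>2 g h k a y q =
    (\<Sum>i<M. \<mu>1 * (g i)\<^sup>2 + \<mu>1 * (h i)\<^sup>2 + (a i)\<^sup>2 / \<mu>1 + (y i)\<^sup>2 / \<mu>1)
    + (\<Sum>j<N. \<mu>2 * (k j)\<^sup>2 + (q j)\<^sup>2 / \<mu>2)"

lemma admm_energy_nonneg:
  assumes "\<mu>1 > 0" and "\<mu>2 > 0"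
  shows "0 \<le> admm_energy M N \<mu>1 \<mu>2 g h k a y q"
  using assms by (auto simp: admm_energy_def intro!: add_nonneg_nonneg sum_nonneg)

lemma admm_energy_ge:
  assumes \<mu>: "\<mu>1 > 0" "\<mu>2 > 0"
  shows "i < M \<Longrightarrow> \<mu>1 * (g i)\<^sup>2 \<le> admm_energy M N \<mu>1 \<mu>2 g h k a y q"
    and "i < M \<Longrightarrow> \<mu>1 * (h i)\<^sup>2 \<le> admm_energy M N \<mu>1 \<mu>2 g h k a y q"
    and "j < N \<Longrightarrow> \<mu>2 * (k j)\<^sup>2 \<le> admm_energy M N \<mu>1 \<mu>2 g h k a y q"
proof -
  let ?F = "\<lambda>i. \<mu>1 * (g i)\<^sup>2 + \<mu>1 * (h i)\<^sup>2 + (a i)\<^sup>2 / \<mu>1 + (y i)\<^sup>2 / \<mu>1"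
  let ?G = "\<lambda>j. \<mu>2 * (k j)\<^sup>2 + (q j)\<^sup>2 / \<mu>2"
  have nn: "0 \<le> \<mu>1 * (g i)\<^sup>2" "0 \<le> \<mu>1 * (h i)\<^sup>2" "0 \<le> (a i)\<^sup>2 / \<mu>1" "0 \<le> (y i)\<^sup>2 / \<mu>1"
    "0 \<le> \<mu>2 * (k i)\<^sup>2" "0 \<le> (q i)\<^sup>2 / \<mu>2" for i
    using \<mu> by auto
  have F0: "0 \<le> ?F i" and G0: "0 \<le> ?G i" for i
    using nn[of i] by linarith+
  have F: "?F i \<le> admm_energy M N \<mu>1 \<mu>2 g h k a y q" if "i < M" for i
  proof -
    have "?F i \<le> (\<Sum>i<M. ?F i)" using that by (intro member_le_sum F0) auto
    moreover have "0 \<le> (\<Sum>j<N. ?G j)" by (intro sum_nonneg G0)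
    ultimately show ?thesis unfolding admm_energy_def by linarith
  qed
  have G: "?G j \<le> admm_energy M N \<mu>1 \<mu>2 g h k a y q" if "j < N" for j
  proof -
    have "?G j \<le> (\<Sum>j<N. ?G j)" using that by (intro member_le_sum G0) auto
    moreover have "0 \<le> (\<Sum>i<M. ?F i)" by (intro sum_nonneg F0)
    ultimately show ?thesis unfolding admm_energy_def by linarith
  qed
  show "i < M \<Longrightarrow> \<mu>1 * (g i)\<^sup>2 \<le> admm_energy M N \<mu>1 \<mu>2 g h k a y q"
    and "i < M \<Longrightarrow> \<mu>1 * (h i)\<^sup>2 \<le> admm_energy M N \<mu>1 \<mu>2 g h k a y q"
    using F[of i] nn[of i] by linarith+
  show "j < N \<Longrightarrow> \<mu>2 * (k j)\<^sup>2 \<le> admm_energy M N \<mu>1 \<mu>2 g h k a y q"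
    using G[of j] nn[of j] by linarith
qed

lemma tendsto_admm_energy:
  assumes "\<And>i. i < M \<Longrightarrow> (\<lambda>n. g n i) \<longlonglongrightarrow> 0" "\<And>i. i < M \<Longrightarrow> (\<lambda>n. h n i) \<longlonglongrightarrow> 0"
    "\<And>j. j < N \<Longrightarrow> (\<lambda>n. k n j) \<longlonglongrightarrow> 0" "\<And>i. i < M \<Longrightarrow> (\<lambda>n. a n i) \<longlonglongrightarrow> 0"
    "\<And>i. i < M \<Longrightarrow> (\<lambda>n. y n i) \<longlonglongrightarrow> 0" "\<And>j. j < N \<Longrightarrow> (\<lambda>n. q n j) \<longlonglongrightarrow> 0"
    and \<mu>: "\<mu>1 > 0" "\<mu>2 > 0"
  shows "(\<lambda>n. admm_energy M N \<mu>1 \<mu>2 (g n) (h n) (k n) (a n) (y n) (q n)) \<longlonglongrightarrow> 0"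
proof -
  have "(\<lambda>n. admm_energy M N \<mu>1 \<mu>2 (g n) (h n) (k n) (a n) (y n) (q n)) \<longlonglongrightarrow>
    (\<Sum>i<M. \<mu>1 * 0\<^sup>2 + \<mu>1 * 0\<^sup>2 + 0\<^sup>2 / \<mu>1 + 0\<^sup>2 / \<mu>1) + (\<Sum>j<N. \<mu>2 * 0\<^sup>2 + 0\<^sup>2 / \<mu>2)"
    unfolding admm_energy_def using \<mu> by (intro tendsto_intros assms) auto
  then show ?thesis by simp
qed

text \<open>Unprimed letters are the errors of one iterate with respect to a KKT point, primed letters those
  of the next; \<open>x, B, w\<close> stand for \<open>d\<^sub>x, D v, v\<close>. The hypotheses
  are the optimality conditions of the four subproblems tested with the errors
  (\<open>sub_x\<close> to \<open>stat_u\<close>), and monotonicity between consecutive iterates.\<close>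

lemma admm_energy_descent:
  fixes \<mu>1 \<mu>2 :: real
  assumes \<mu>: "\<mu>1 > 0" "\<mu>2 > 0"
    and sub_x: "0 \<le> (\<Sum>i<M. (g' i + (a i - a' i) / \<mu>1) * x' i)"
    and sub_y: "0 \<le> (\<Sum>i<M. h' i * y' i)"
    and stat_v: "(\<Sum>i<M. (h' i + (y' i - y i) / \<mu>1) * B' i) = (\<Sum>j<N. (k' j + (q j - q' j) / \<mu>2) * w' j)"
    and stat_u: "(\<Sum>j<N. (u' j)\<^sup>2) + (\<Sum>i<M. g' i * a' i) + (\<Sum>j<N. k' j * q' j) = 0"
    and mono_y: "0 \<le> (\<Sum>i<M. (h' i - h i) * (y' i - y i))"
    and mono_u: "(\<Sum>j<N. (u' j - u j)\<^sup>2) + (\<Sum>i<M. (g' i - g i) * (a' i - a i))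
      + (\<Sum>j<N. (k' j - k j) * (q' j - q j)) = 0"
    and step_x: "\<And>i. i < M \<Longrightarrow> x' i = a' i - \<mu>1 * (g' i - g i)"
    and step_y: "\<And>i. i < M \<Longrightarrow> B' i = y' i + \<mu>1 * (h' i - h i)"
    and step_z: "\<And>j. j < N \<Longrightarrow> w' j = q' j - \<mu>2 * (k' j - k j)"
  shows "admm_energy M N \<mu>1 \<mu>2 g' h' k' a' y' q'
      + (admm_energy M N \<mu>1 \<mu>2 (\<lambda>i. g' i - g i) (\<lambda>i. h' i - h i) (\<lambda>i. k' i - k i)
          (\<lambda>i. a' i - a i) (\<lambda>i. y' i - y i) (\<lambda>i. q' i - q i)
        + 2 * (\<Sum>j<N. (u' j)\<^sup>2))
    \<le> admm_energy M N \<mu>1 \<mu>2 g h k a y q"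
proof -
  define S1 S2 S3 S4 S5 S6 where
    S: "S1 = (\<Sum>i<M. (g' i + (a i - a' i) / \<mu>1) * x' i)" "S2 = (\<Sum>i<M. h' i * y' i)"
    "S3 = (\<Sum>i<M. (h' i + (y' i - y i) / \<mu>1) * B' i)" "S4 = (\<Sum>i<M. g' i * a' i)"
    "S5 = (\<Sum>i<M. (h' i - h i) * (y' i - y i))" "S6 = (\<Sum>i<M. (g' i - g i) * (a' i - a i))"
  define T1 T2 T3 where
    T: "T1 = (\<Sum>j<N. (k' j + (q j - q' j) / \<mu>2) * w' j)" "T2 = (\<Sum>j<N. k' j * q' j)"
    "T3 = (\<Sum>j<N. (k' j - k j) * (q' j - q j))"
  define e where "e g h a y i = \<mu>1 * (g i)\<^sup>2 + \<mu>1 * (h i)\<^sup>2 + (a i)\<^sup>2 / \<mu>1 + (y i)\<^sup>2 / \<mu>1"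
    for g h a y :: "nat \<Rightarrow> real" and i
  define f where "f k q j = \<mu>2 * (k j)\<^sup>2 + (q j)\<^sup>2 / \<mu>2" for k q :: "nat \<Rightarrow> real" and j
  have E: "admm_energy M N \<mu>1 \<mu>2 g h k a y q = (\<Sum>i<M. e g h a y i) + (\<Sum>j<N. f k q j)"
    for g h k a y q by (simp add: admm_energy_def e_def f_def)
  let ?de = "e (\<lambda>i. g' i - g i) (\<lambda>i. h' i - h i) (\<lambda>i. a' i - a i) (\<lambda>i. y' i - y i)"
  let ?df = "f (\<lambda>i. k' i - k i) (\<lambda>i. q' i - q i)"
  \<comment> \<open>Each square contributes \<open>p'\<^sup>2 + (p' - p)\<^sup>2 - p\<^sup>2 = 2 *
    p' * (p' - p)\<close>. Substituting the multiplier updates into \<open>S1\<close> and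
    \<open>S3\<close> produces these products and cross terms between multiplier and primal
    increments; \<open>S6\<close> and \<open>S5\<close> cancel the cross terms. In the sum with
    \<open>Npart\<close>, \<open>S3\<close> cancels \<open>T1\<close>, and \<open>S4 + T2\<close>
    and \<open>S6 + T3\<close> become negative sums of squares.\<close>
  have Mpart: "(\<Sum>i<M. e g' h' a' y' i) + (\<Sum>i<M. ?de i) - (\<Sum>i<M. e g h a y i)
      = 2 * (- S1 - S2 + S3 + S4 - S5 + S6)"
    unfolding S sum.distrib[symmetric] sum_subtractf[symmetric] sum_distrib_left sum_negf[symmetric]
    using \<mu> by (intro sum.cong refl) (simp add: e_def step_x step_y power2_eq_square field_simps)
  have Npart: "(\<Sum>j<N. f k' q' j) + (\<Sum>j<N. ?df j) - (\<Sum>j<N. f k q j) = 2 * (- T1 + T2 + T3)"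
    unfolding T sum.distrib[symmetric] sum_subtractf[symmetric] sum_distrib_left sum_negf[symmetric]
    using \<mu> by (intro sum.cong refl) (simp add: f_def step_z power2_eq_square field_simps)
  have "0 \<le> (\<Sum>j<N. (u' j - u j)\<^sup>2)" by (simp add: sum_nonneg)
  with sub_x sub_y stat_v stat_u mono_y mono_u Mpart Npart show ?thesis
    unfolding E S[symmetric] T[symmetric] by argo
qed

section \<open>The iteration\<close>

text \<open>\<open>dx 0\<close> and \<open>v 0\<close> stay unspecified: a step overwrites the first
  block before reading it, so facts about \<open>dx\<close> and \<open>v\<close> start at
  \<open>Suc k\<close>.\<close>

locale admm = denoising +
  fixes \<mu>1 \<mu>2 :: real and dx dy u v \<gamma>x \<gamma>y \<gamma>z :: "nat \<Rightarrow> real vec"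
  assumes \<mu>: "\<mu>1 > 0" "\<mu>2 > 0"
    and init: "u 0 \<in> carrier_vec N" "dy 0 \<in> carrier_vec M"
      "\<gamma>x 0 \<in> carrier_vec M" "\<gamma>y 0 \<in> carrier_vec M" "\<gamma>z 0 \<in> carrier_vec N"
    and dx_step: "\<And>k. dx (Suc k) = soft_threshold (D *\<^sub>v u k + \<mu>1 \<cdot>\<^sub>v \<gamma>x k) (lam * \<mu>1)"
    and v_step: "\<And>k. v (Suc k) \<in> carrier_vec N"
      "\<And>k. (D\<^sup>T * D + (\<mu>1 / \<mu>2) \<cdot>\<^sub>m 1\<^sub>m N) *\<^sub>v v (Suc k) =
         D\<^sup>T *\<^sub>v (dy k - \<mu>1 \<cdot>\<^sub>v \<gamma>y k) + \<mu>1 \<cdot>\<^sub>v \<gamma>z k + (\<mu>1 / \<mu>2) \<cdot>\<^sub>v (P *\<^sub>v u k)"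
    and dy_step: "\<And>k. dy (Suc k) = soft_threshold (D *\<^sub>v v (Suc k) + \<mu>1 \<cdot>\<^sub>v \<gamma>y k) (lam * \<mu>1)"
    and u_step: "\<And>k. u (Suc k) \<in> carrier_vec N"
      "\<And>k. (D\<^sup>T * D + (\<mu>1 / \<mu>2 + \<mu>1) \<cdot>\<^sub>m 1\<^sub>m N) *\<^sub>v u (Suc k) =
         \<mu>1 \<cdot>\<^sub>v b + D\<^sup>T *\<^sub>v (dx (Suc k) - \<mu>1 \<cdot>\<^sub>v \<gamma>x k)
         + P\<^sup>T *\<^sub>v ((\<mu>1 / \<mu>2) \<cdot>\<^sub>v v (Suc k) - \<mu>1 \<cdot>\<^sub>v \<gamma>z k)"
    and \<gamma>x_step: "\<And>k. \<gamma>x (Suc k) = \<gamma>x k + (1 / \<mu>1) \<cdot>\<^sub>v (D *\<^sub>v u (Suc k) - dx (Suc k))"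
    and \<gamma>y_step: "\<And>k. \<gamma>y (Suc k) = \<gamma>y k + (1 / \<mu>1) \<cdot>\<^sub>v (D *\<^sub>v v (Suc k) - dy (Suc k))"
    and \<gamma>z_step: "\<And>k. \<gamma>z (Suc k) = \<gamma>z k + (1 / \<mu>2) \<cdot>\<^sub>v (P *\<^sub>v u (Suc k) - v (Suc k))"
begin

lemma DT: "D\<^sup>T \<in> carrier_mat N M" and PT: "P\<^sup>T \<in> carrier_mat N N"
  using D P by auto

lemma u_carrier: "u k \<in> carrier_vec N"
  using init u_step by (cases k) auto

lemma dim_vec_soft_threshold: "dim_vec (soft_threshold x t) = dim_vec x"
  by (simp add: soft_threshold_def)

lemma \<gamma>_carrier: "\<gamma>x k \<in> carrier_vec M" "\<gamma>y k \<in> carrier_vec M" "\<gamma>z k \<in> carrier_vec N"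
proof -
  have "dim_vec (\<gamma>x k) = M"
    by (induction k) (simp_all add: \<gamma>x_step dx_step dim_vec_soft_threshold carrier_vecD[OF init(3)])
  then show "\<gamma>x k \<in> carrier_vec M" by (rule carrier_vecI)
  have "dim_vec (\<gamma>y k) = M"
    by (induction k) (simp_all add: \<gamma>y_step dy_step dim_vec_soft_threshold carrier_vecD[OF init(4)])
  then show "\<gamma>y k \<in> carrier_vec M" by (rule carrier_vecI)
  have "dim_vec (\<gamma>z k) = N"
    by (cases k) (simp_all add: \<gamma>z_step carrier_vecD[OF init(5)] carrier_vecD[OF v_step(1)])
  then show "\<gamma>z k \<in> carrier_vec N" by (rule carrier_vecI)
qed

lemma dx_carrier: "dx (Suc k) \<in> carrier_vec M"
  by (intro carrier_vecI) (simp add: dx_step dim_vec_soft_threshold carrier_vecD[OF \<gamma>_carrier(1)])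

lemma dy_carrier: "dy k \<in> carrier_vec M"
proof (cases k)
  case (Suc l)
  show ?thesis unfolding Suc
    by (intro carrier_vecI) (simp add: dy_step dim_vec_soft_threshold carrier_vecD[OF \<gamma>_carrier(2)])
qed (use init in simp)

lemmas carriers = u_carrier v_step(1) dx_carrier dy_carrier \<gamma>_carrier b

lemmas dims = carriers[THEN carrier_vecD] D[THEN carrier_matD(1)] D[THEN carrier_matD(2)]
  P[THEN carrier_matD(1)] P[THEN carrier_matD(2)]

section \<open>Optimality conditions of the subproblems at the new multipliers\<close>

lemma \<gamma>x_index: "i < M \<Longrightarrow> \<gamma>x (Suc k) $ i = \<gamma>x k $ i + ((D *\<^sub>v u (Suc k)) $ i - dx (Suc k) $ i) / \<mu>1"
  and \<gamma>y_index: "i < M \<Longrightarrow> \<gamma>y (Suc k) $ i = \<gamma>y k $ i + ((D *\<^sub>v v (Suc k)) $ i - dy (Suc k) $ i) / \<mu>1"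
  and \<gamma>z_index: "j < N \<Longrightarrow> \<gamma>z (Suc k) $ j = \<gamma>z k $ j + ((P *\<^sub>v u (Suc k)) $ j - v (Suc k) $ j) / \<mu>2"
  by (simp_all add: \<gamma>x_step \<gamma>y_step \<gamma>z_step dims del: index_mult_mat_vec)

text \<open>The threshold is applied to the old \<open>u\<close>, whereas the multiplier update uses
  the new one; the difference is the correction term. For \<open>dy\<close> both use the same
  \<open>v (Suc k)\<close>, so no correction arises.\<close>

lemma dx_subgradient:
  assumes "i < M"
  shows "abs_subgradient lam (\<gamma>x (Suc k) $ i + ((D *\<^sub>v u k) $ i - (D *\<^sub>v u (Suc k)) $ i) / \<mu>1)
    (dx (Suc k) $ i)"
proof -
  define x where "x = (D *\<^sub>v u k) $ i + \<mu>1 * \<gamma>x k $ i"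
  have "dx (Suc k) $ i = max (\<bar>x\<bar> - lam * \<mu>1) 0 * sgn x"
    using assms \<gamma>_carrier(1)[of k] D
    by (simp add: dx_step soft_threshold_def x_def del: index_mult_mat_vec)
  from soft_threshold_abs_subgradient[OF _ this]
  have "abs_subgradient (lam * \<mu>1) (x - dx (Suc k) $ i) (dx (Suc k) $ i)"
    using lam \<mu> by simp
  moreover have "x - dx (Suc k) $ i =
      \<mu>1 * (\<gamma>x (Suc k) $ i + ((D *\<^sub>v u k) $ i - (D *\<^sub>v u (Suc k)) $ i) / \<mu>1)"
    using \<mu> assms by (simp add: \<gamma>x_index x_def field_simps del: index_mult_mat_vec)
  ultimately show ?thesis using abs_subgradient_scale[OF \<mu>(1)] by metis
qed

lemma dy_subgradient:
  assumes "i < M"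
  shows "abs_subgradient lam (\<gamma>y (Suc k) $ i) (dy (Suc k) $ i)"
proof -
  define x where "x = (D *\<^sub>v v (Suc k)) $ i + \<mu>1 * \<gamma>y k $ i"
  have "dy (Suc k) $ i = max (\<bar>x\<bar> - lam * \<mu>1) 0 * sgn x"
    using assms \<gamma>_carrier(2)[of k] D
    by (simp add: dy_step soft_threshold_def x_def del: index_mult_mat_vec)
  from soft_threshold_abs_subgradient[OF _ this]
  have "abs_subgradient (lam * \<mu>1) (x - dy (Suc k) $ i) (dy (Suc k) $ i)"
    using lam \<mu> by simp
  moreover have "x - dy (Suc k) $ i = \<mu>1 * \<gamma>y (Suc k) $ i"
    using \<mu> assms by (simp add: \<gamma>y_index x_def field_simps del: index_mult_mat_vec)
  ultimately show ?thesis using abs_subgradient_scale[OF \<mu>(1)] by metis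
qed

lemma gram_mult_index:
  assumes "w \<in> carrier_vec N" and "j < N"
  shows "((D\<^sup>T * D + c \<cdot>\<^sub>m 1\<^sub>m N) *\<^sub>v w) $ j = (D\<^sup>T *\<^sub>v (D *\<^sub>v w)) $ j + c * w $ j"
proof -
  have "(c \<cdot>\<^sub>m 1\<^sub>m N) *\<^sub>v w = c \<cdot>\<^sub>v w"
    using assms(1) by (intro eq_vecI) auto
  moreover have "(D\<^sup>T * D) *\<^sub>v w = D\<^sup>T *\<^sub>v (D *\<^sub>v w)"
    by (rule assoc_mult_mat_vec[OF DT D assms(1)])
  ultimately have "(D\<^sup>T * D + c \<cdot>\<^sub>m 1\<^sub>m N) *\<^sub>v w = D\<^sup>T *\<^sub>v (D *\<^sub>v w) + c \<cdot>\<^sub>v w"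
    using D assms by (subst add_mult_distrib_mat_vec[of _ N N]) auto
  then show ?thesis using D assms by (simp del: index_mult_mat_vec)
qed

text \<open>The normal equation of the \<open>v\<close> step, divided by \<open>\<mu>1\<close> and
  rewritten with the new multipliers. It contains the old \<open>dy\<close> and \<open>u\<close>,
  hence the two differences of consecutive iterates.\<close>

lemma v_stationary:
  assumes j: "j < N"
  shows "(D\<^sup>T *\<^sub>v \<gamma>y (Suc k)) $ j + ((D\<^sup>T *\<^sub>v dy (Suc k)) $ j - (D\<^sup>T *\<^sub>v dy k) $ j) / \<mu>1 =
    \<gamma>z (Suc k) $ j + ((P *\<^sub>v u k) $ j - (P *\<^sub>v u (Suc k)) $ j) / \<mu>2"
proof -
  have Dv: "D *\<^sub>v w \<in> carrier_vec M" "P *\<^sub>v w \<in> carrier_vec N" for w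
    by (rule carrier_vecI, simp add: dims)+
  have "(D\<^sup>T *\<^sub>v (D *\<^sub>v v (Suc k))) $ j + \<mu>1 / \<mu>2 * v (Suc k) $ j =
      (D\<^sup>T *\<^sub>v dy k) $ j - \<mu>1 * (D\<^sup>T *\<^sub>v \<gamma>y k) $ j + \<mu>1 * \<gamma>z k $ j + \<mu>1 / \<mu>2 * (P *\<^sub>v u k) $ j"
    apply (subst gram_mult_index[OF v_step(1) j, symmetric])
    apply (subst v_step(2))
    using j
    by (simp add: carriers Dv mult_minus_distrib_mat_vec[OF DT] mult_mat_vec[OF DT] dims
        del: index_mult_mat_vec)
  moreover have "(D\<^sup>T *\<^sub>v \<gamma>y (Suc k)) $ j = (D\<^sup>T *\<^sub>v \<gamma>y k) $ j
      + ((D\<^sup>T *\<^sub>v (D *\<^sub>v v (Suc k))) $ j - (D\<^sup>T *\<^sub>v dy (Suc k)) $ j) / \<mu>1"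
    unfolding \<gamma>y_step using j
    by (simp add: carriers Dv mult_add_distrib_mat_vec[OF DT]
        mult_minus_distrib_mat_vec[OF DT]
        mult_mat_vec[OF DT] dims del: index_mult_mat_vec)
  moreover have "g' + (t2 - t0) / \<mu>1 = z + (p' - w) / \<mu>2 + (p - p') / \<mu>2"
    if "t1 + \<mu>1 / \<mu>2 * w = t0 - \<mu>1 * g + \<mu>1 * z + \<mu>1 / \<mu>2 * p" and "g' = g + (t1 - t2) / \<mu>1"
    for t0 t1 t2 w g g' z p p'
  proof -
    have "t1 = t0 - \<mu>1 * g + \<mu>1 * z + \<mu>1 / \<mu>2 * p - \<mu>1 / \<mu>2 * w" using that(1) by linarith
    then have "t1 / \<mu>1 = t0 / \<mu>1 - g + z + p / \<mu>2 - w / \<mu>2"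
      using \<mu> by (simp add: add_divide_distrib diff_divide_distrib)
    then show ?thesis unfolding that(2) by (simp add: diff_divide_distrib)
  qed
  ultimately show ?thesis
    unfolding \<gamma>z_index[OF j] by metis
qed

text \<open>The \<open>u\<close> step comes after all the other primal updates, so its normal
  equation becomes an exact stationarity condition at the new multipliers.\<close>

lemma u_stationary:
  assumes j: "j < N"
  shows "u (Suc k) $ j + (D\<^sup>T *\<^sub>v \<gamma>x (Suc k)) $ j + (P\<^sup>T *\<^sub>v \<gamma>z (Suc k)) $ j = b $ j"
proof -
  have Dv: "D *\<^sub>v w \<in> carrier_vec M" "P *\<^sub>v w \<in> carrier_vec N" for w
    by (rule carrier_vecI, simp add: dims)+
  \<comment> \<open>Orthogonality of \<open>P\<close> is why the penalty on \<open>P u - v\<close>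
    appears in the \<open>u\<close> system as a multiple of the identity.\<close>
  have Pu: "P\<^sup>T *\<^sub>v (P *\<^sub>v u (Suc k)) = u (Suc k)"
    using assoc_mult_mat_vec[OF PT P u_step(1)] P_orth u_step(1) by simp
  have "(D\<^sup>T *\<^sub>v (D *\<^sub>v u (Suc k))) $ j + (\<mu>1 / \<mu>2 + \<mu>1) * u (Suc k) $ j =
      \<mu>1 * b $ j + (D\<^sup>T *\<^sub>v dx (Suc k)) $ j - \<mu>1 * (D\<^sup>T *\<^sub>v \<gamma>x k) $ j
      + \<mu>1 / \<mu>2 * (P\<^sup>T *\<^sub>v v (Suc k)) $ j - \<mu>1 * (P\<^sup>T *\<^sub>v \<gamma>z k) $ j"
    apply (subst gram_mult_index[OF u_step(1) j, symmetric])
    apply (subst u_step(2))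
    using j
    by (simp add: carriers Dv mult_minus_distrib_mat_vec[OF DT] mult_mat_vec[OF DT]
        mult_minus_distrib_mat_vec[OF PT] mult_mat_vec[OF PT] dims del: index_mult_mat_vec)
  moreover have "(D\<^sup>T *\<^sub>v \<gamma>x (Suc k)) $ j = (D\<^sup>T *\<^sub>v \<gamma>x k) $ j
      + ((D\<^sup>T *\<^sub>v (D *\<^sub>v u (Suc k))) $ j - (D\<^sup>T *\<^sub>v dx (Suc k)) $ j) / \<mu>1"
    unfolding \<gamma>x_step using j
    by (simp add: carriers Dv mult_add_distrib_mat_vec[OF DT]
        mult_minus_distrib_mat_vec[OF DT]
        mult_mat_vec[OF DT] dims del: index_mult_mat_vec)
  moreover have "(P\<^sup>T *\<^sub>v \<gamma>z (Suc k)) $ j = (P\<^sup>T *\<^sub>v \<gamma>z k) $ j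
      + (u (Suc k) $ j - (P\<^sup>T *\<^sub>v v (Suc k)) $ j) / \<mu>2"
    unfolding \<gamma>z_step using j
    by (simp add: carriers Dv mult_add_distrib_mat_vec[OF PT]
        mult_minus_distrib_mat_vec[OF PT]
        mult_mat_vec[OF PT] Pu dims del: index_mult_mat_vec)
  moreover have "u' + g' + z' = b'"
    if "t1 + (\<mu>1 / \<mu>2 + \<mu>1) * u' = \<mu>1 * b' + t2 - \<mu>1 * g + \<mu>1 / \<mu>2 * w - \<mu>1 * z"
      and "g' = g + (t1 - t2) / \<mu>1" and "z' = z + (u' - w) / \<mu>2"
    for t1 t2 u' g g' z z' w b'
  proof -
    have "t1 = \<mu>1 * b' + t2 - \<mu>1 * g + \<mu>1 / \<mu>2 * w - \<mu>1 * z - \<mu>1 / \<mu>2 * u' - \<mu>1 * u'"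
      using that(1) by (simp add: distrib_right)
    then have "t1 / \<mu>1 = b' + t2 / \<mu>1 - g + w / \<mu>2 - z - u' / \<mu>2 - u'"
      using \<mu> by (simp add: add_divide_distrib diff_divide_distrib)
    then show ?thesis unfolding that(2,3) by (simp add: diff_divide_distrib)
  qed
  ultimately show ?thesis by metis
qed

text \<open>Subtracting the two equations removes \<open>b\<close>; pairing the difference with
  \<open>w - w'\<close> gives the identity. It serves both for an iterate against a KKT point and
  for two consecutive iterates.\<close>

lemma stationary_pair:
  assumes c: "w \<in> carrier_vec N" "g \<in> carrier_vec M" "z \<in> carrier_vec N"
    "w' \<in> carrier_vec N" "g' \<in> carrier_vec M" "z' \<in> carrier_vec N"
    and "\<And>j. j < N \<Longrightarrow> w $ j + (D\<^sup>T *\<^sub>v g) $ j + (P\<^sup>T *\<^sub>v z) $ j = b $ j"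
    and "\<And>j. j < N \<Longrightarrow> w' $ j + (D\<^sup>T *\<^sub>v g') $ j + (P\<^sup>T *\<^sub>v z') $ j = b $ j"
  shows "(\<Sum>j<N. (w $ j - w' $ j)\<^sup>2) + (\<Sum>i<M. (g $ i - g' $ i) * ((D *\<^sub>v w) $ i - (D *\<^sub>v w') $ i))
    + (\<Sum>j<N. (z $ j - z' $ j) * ((P *\<^sub>v w) $ j - (P *\<^sub>v w') $ j)) = 0"
  unfolding sum_mult_mat_vec_adjoint_diff[OF D c(1,4) c(2,5)]
    sum_mult_mat_vec_adjoint_diff[OF P c(1,4) c(3,6)] sum.distrib[symmetric]
proof (rule sum.neutral, rule ballI)
  fix j assume "j \<in> {..<N}"
  then have "w $ j - w' $ j + ((D\<^sup>T *\<^sub>v g) $ j - (D\<^sup>T *\<^sub>v g') $ j)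
      + ((P\<^sup>T *\<^sub>v z) $ j - (P\<^sup>T *\<^sub>v z') $ j) = 0"
    using assms(7,8)[of j] by (simp del: index_mult_mat_vec)
  moreover have "(w $ j - w' $ j)\<^sup>2 + p * (w $ j - w' $ j) + q * (w $ j - w' $ j)
    = (w $ j - w' $ j + p + q) * (w $ j - w' $ j)" for p q
    by (simp add: power2_eq_square algebra_simps)
  ultimately show "(w $ j - w' $ j)\<^sup>2
      + ((D\<^sup>T *\<^sub>v g) $ j - (D\<^sup>T *\<^sub>v g') $ j) * (w $ j - w' $ j)
      + ((P\<^sup>T *\<^sub>v z) $ j - (P\<^sup>T *\<^sub>v z') $ j) * (w $ j - w' $ j) = 0"
    by simp
qed

section \<open>Descent of the energy along the iteration\<close>

definition energy :: "real vec \<Rightarrow> real vec \<Rightarrow> real vec \<Rightarrow> real vec \<Rightarrow> real vec \<Rightarrow> real vec \<Rightarrow> nat \<Rightarrow> real"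
  where "energy dx' dy' v' \<gamma>x' \<gamma>y' \<gamma>z' k = admm_energy M N \<mu>1 \<mu>2
    (\<lambda>i. \<gamma>x k $ i - \<gamma>x' $ i) (\<lambda>i. \<gamma>y k $ i - \<gamma>y' $ i) (\<lambda>j. \<gamma>z k $ j - \<gamma>z' $ j)
    (\<lambda>i. (D *\<^sub>v u k) $ i - dx' $ i) (\<lambda>i. dy k $ i - dy' $ i) (\<lambda>j. (P *\<^sub>v u k) $ j - v' $ j)"

text \<open>The reference point cancels in the difference of two errors, so one quantity serves all
  KKT points.\<close>

definition increment :: "nat \<Rightarrow> real"
  where "increment k = admm_energy M N \<mu>1 \<mu>2
    (\<lambda>i. \<gamma>x (Suc k) $ i - \<gamma>x k $ i) (\<lambda>i. \<gamma>y (Suc k) $ i - \<gamma>y k $ i) (\<lambda>j. \<gamma>z (Suc k) $ j - \<gamma>z k $ j)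
    (\<lambda>i. (D *\<^sub>v u (Suc k)) $ i - (D *\<^sub>v u k) $ i) (\<lambda>i. dy (Suc k) $ i - dy k $ i)
    (\<lambda>j. (P *\<^sub>v u (Suc k)) $ j - (P *\<^sub>v u k) $ j)"

text \<open>Starting at \<open>Suc k\<close> ensures that both iterates compared in
  \<open>mono_y\<close> and \<open>mono_u\<close> come out of a step and satisfy the second-block
  conditions.\<close>

lemma energy_descent:
  assumes kkt: "kkt dx' dy' u' v' \<gamma>x' \<gamma>y' \<gamma>z'"
  shows "energy dx' dy' v' \<gamma>x' \<gamma>y' \<gamma>z' (Suc (Suc k))
      + (increment (Suc k) + 2 * (\<Sum>j<N. (u (Suc (Suc k)) $ j - u' $ j)\<^sup>2))
    \<le> energy dx' dy' v' \<gamma>x' \<gamma>y' \<gamma>z' (Suc k)"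
proof -
  note c' = kkt_carrier[OF kkt]
  have eqs: "dx' = D *\<^sub>v u'" "v' = P *\<^sub>v u'" "dy' = D *\<^sub>v v'" "\<gamma>z' = D\<^sup>T *\<^sub>v \<gamma>y'"
    and stat: "\<And>j. j < N \<Longrightarrow> u' $ j + (D\<^sup>T *\<^sub>v \<gamma>x') $ j + (P\<^sup>T *\<^sub>v \<gamma>z') $ j = b $ j"
    and subx: "\<And>i. i < M \<Longrightarrow> abs_subgradient lam (\<gamma>x' $ i) (dx' $ i)"
    and suby: "\<And>i. i < M \<Longrightarrow> abs_subgradient lam (\<gamma>y' $ i) (dy' $ i)"
    using kkt unfolding kkt_def by blast+
  let ?l = "Suc (Suc k)" and ?m = "Suc k"
  have cancel: "x - z - (y - z) = x - y" "y - z - (x - z) = y - x" for x y z :: real by auto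
  have sub_x: "0 \<le> (\<Sum>i<M. ((\<gamma>x ?l $ i - \<gamma>x' $ i)
      + (((D *\<^sub>v u ?m) $ i - dx' $ i) - ((D *\<^sub>v u ?l) $ i - dx' $ i)) / \<mu>1) * (dx ?l $ i - dx' $ i))"
  proof (rule sum_nonneg)
    fix i assume "i \<in> {..<M}"
    then have "0 \<le> ((\<gamma>x ?l $ i + ((D *\<^sub>v u ?m) $ i - (D *\<^sub>v u ?l) $ i) / \<mu>1) - \<gamma>x' $ i) * (dx ?l $ i - dx' $ i)"
      by (intro abs_subgradient_mono[of lam] dx_subgradient subx) auto
    then show "0 \<le> ((\<gamma>x ?l $ i - \<gamma>x' $ i)
      + (((D *\<^sub>v u ?m) $ i - dx' $ i) - ((D *\<^sub>v u ?l) $ i - dx' $ i)) / \<mu>1) * (dx ?l $ i - dx' $ i)"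
      unfolding cancel by (simp only: add_diff_eq diff_add_eq)
  qed
  have sub_y: "0 \<le> (\<Sum>i<M. (\<gamma>y ?l $ i - \<gamma>y' $ i) * (dy ?l $ i - dy' $ i))"
    by (intro sum_nonneg abs_subgradient_mono[of lam] dy_subgradient suby) auto
  have mono_y: "0 \<le> (\<Sum>i<M. ((\<gamma>y ?l $ i - \<gamma>y' $ i) - (\<gamma>y ?m $ i - \<gamma>y' $ i))
      * ((dy ?l $ i - dy' $ i) - (dy ?m $ i - dy' $ i)))"
    unfolding cancel by (intro sum_nonneg abs_subgradient_mono[of lam] dy_subgradient) auto
  have stat_u: "(\<Sum>j<N. (u ?l $ j - u' $ j)\<^sup>2)
      + (\<Sum>i<M. (\<gamma>x ?l $ i - \<gamma>x' $ i) * ((D *\<^sub>v u ?l) $ i - dx' $ i))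
      + (\<Sum>j<N. (\<gamma>z ?l $ j - \<gamma>z' $ j) * ((P *\<^sub>v u ?l) $ j - v' $ j)) = 0"
    unfolding eqs(1,2) by (intro stationary_pair carriers c' u_stationary stat)
  have mono_u: "(\<Sum>j<N. ((u ?l $ j - u' $ j) - (u ?m $ j - u' $ j))\<^sup>2)
      + (\<Sum>i<M. ((\<gamma>x ?l $ i - \<gamma>x' $ i) - (\<gamma>x ?m $ i - \<gamma>x' $ i))
        * (((D *\<^sub>v u ?l) $ i - dx' $ i) - ((D *\<^sub>v u ?m) $ i - dx' $ i)))
      + (\<Sum>j<N. ((\<gamma>z ?l $ j - \<gamma>z' $ j) - (\<gamma>z ?m $ j - \<gamma>z' $ j))
        * (((P *\<^sub>v u ?l) $ j - v' $ j) - ((P *\<^sub>v u ?m) $ j - v' $ j))) = 0"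
    unfolding cancel by (intro stationary_pair carriers u_stationary)
  have stat_v: "(\<Sum>i<M. ((\<gamma>y ?l $ i - \<gamma>y' $ i) + ((dy ?l $ i - dy' $ i) - (dy ?m $ i - dy' $ i)) / \<mu>1)
        * ((D *\<^sub>v v ?l) $ i - dy' $ i))
    = (\<Sum>j<N. ((\<gamma>z ?l $ j - \<gamma>z' $ j) + (((P *\<^sub>v u ?m) $ j - v' $ j) - ((P *\<^sub>v u ?l) $ j - v' $ j)) / \<mu>2)
        * (v ?l $ j - v' $ j))"
  proof -
    \<comment> \<open>By the update of \<open>\<gamma>y\<close>, this is the multiplier that would
      result from using the old \<open>dy\<close>. It is the one for which
      \<open>v_stationary\<close> becomes a single equation for
      \<open>D\<^sup>T *\<^sub>v W\<close>.\<close>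
    define W where "W = \<gamma>y ?l + (1 / \<mu>1) \<cdot>\<^sub>v (dy ?l - dy ?m)"
    have W: "W \<in> carrier_vec M" unfolding W_def by (intro carrier_vecI) (simp add: dims)
    have "(\<Sum>i<M. ((\<gamma>y ?l $ i - \<gamma>y' $ i) + ((dy ?l $ i - dy' $ i) - (dy ?m $ i - dy' $ i)) / \<mu>1)
          * ((D *\<^sub>v v ?l) $ i - dy' $ i))
        = (\<Sum>i<M. (W $ i - \<gamma>y' $ i) * ((D *\<^sub>v v ?l) $ i - (D *\<^sub>v v') $ i))"
      unfolding cancel
      by (intro sum.cong refl arg_cong2[where f = "(*)"])
        (simp_all add: W_def dims eqs(3)[symmetric] del: index_mult_mat_vec)
    also have "\<dots> = (\<Sum>j<N. ((D\<^sup>T *\<^sub>v W) $ j - (D\<^sup>T *\<^sub>v \<gamma>y') $ j) * (v ?l $ j - v' $ j))"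
      by (rule sum_mult_mat_vec_adjoint_diff[OF D _ _ W]) (intro carriers c')+
    also have "\<dots> = (\<Sum>j<N. ((\<gamma>z ?l $ j - \<gamma>z' $ j)
        + (((P *\<^sub>v u ?m) $ j - v' $ j) - ((P *\<^sub>v u ?l) $ j - v' $ j)) / \<mu>2) * (v ?l $ j - v' $ j))"
    proof (intro sum.cong refl)
      fix j assume "j \<in> {..<N}"
      then have j: "j < N" by simp
      have "D\<^sup>T *\<^sub>v W = D\<^sup>T *\<^sub>v \<gamma>y ?l + (1 / \<mu>1) \<cdot>\<^sub>v (D\<^sup>T *\<^sub>v dy ?l - D\<^sup>T *\<^sub>v dy ?m)"
        unfolding W_def
        by (simp add: mult_add_distrib_mat_vec[OF DT] mult_mat_vec[OF DT]
            mult_minus_distrib_mat_vec[OF DT] carriers)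
      then have "(D\<^sup>T *\<^sub>v W) $ j = \<gamma>z ?l $ j + ((P *\<^sub>v u ?m) $ j - (P *\<^sub>v u ?l) $ j) / \<mu>2"
        unfolding v_stationary[OF j, symmetric] using j
        by (simp add: dims del: index_mult_mat_vec)
      then show "((D\<^sup>T *\<^sub>v W) $ j - (D\<^sup>T *\<^sub>v \<gamma>y') $ j) * (v ?l $ j - v' $ j)
        = ((\<gamma>z ?l $ j - \<gamma>z' $ j)
        + (((P *\<^sub>v u ?m) $ j - v' $ j) - ((P *\<^sub>v u ?l) $ j - v' $ j)) / \<mu>2) * (v ?l $ j - v' $ j)"
        unfolding cancel eqs(4) by (simp only: add_diff_eq diff_add_eq)
    qed
    finally show ?thesis .
  qed
  have step_x: "dx ?l $ i - dx' $ i = ((D *\<^sub>v u ?l) $ i - dx' $ i)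
      - \<mu>1 * ((\<gamma>x ?l $ i - \<gamma>x' $ i) - (\<gamma>x ?m $ i - \<gamma>x' $ i))" if "i < M" for i
    using \<mu> unfolding cancel \<gamma>x_index[OF that, of ?m] by (simp del: index_mult_mat_vec)
  have step_y: "(D *\<^sub>v v ?l) $ i - dy' $ i = (dy ?l $ i - dy' $ i)
      + \<mu>1 * ((\<gamma>y ?l $ i - \<gamma>y' $ i) - (\<gamma>y ?m $ i - \<gamma>y' $ i))" if "i < M" for i
    using \<mu> unfolding cancel \<gamma>y_index[OF that, of ?m] by (simp del: index_mult_mat_vec)
  have step_z: "v ?l $ j - v' $ j = ((P *\<^sub>v u ?l) $ j - v' $ j)
      - \<mu>2 * ((\<gamma>z ?l $ j - \<gamma>z' $ j) - (\<gamma>z ?m $ j - \<gamma>z' $ j))" if "j < N" for j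
    using \<mu> unfolding cancel \<gamma>z_index[OF that, of ?m] by (simp del: index_mult_mat_vec)
  from admm_energy_descent[OF \<mu> sub_x sub_y stat_v stat_u mono_y mono_u step_x step_y step_z]
  show ?thesis unfolding cancel energy_def increment_def .
qed

lemma energy_nonneg: "0 \<le> energy dx' dy' v' \<gamma>x' \<gamma>y' \<gamma>z' k"
  and increment_nonneg: "0 \<le> increment k"
  unfolding energy_def increment_def by (rule admm_energy_nonneg[OF \<mu>])+

lemma decseq_energy:
  assumes "kkt dx' dy' u' v' \<gamma>x' \<gamma>y' \<gamma>z'"
  shows "decseq (\<lambda>k. energy dx' dy' v' \<gamma>x' \<gamma>y' \<gamma>z' (Suc k))"
proof (rule decseq_SucI)
  fix k
  have "0 \<le> (\<Sum>j<N. (u (Suc (Suc k)) $ j - u' $ j)\<^sup>2)" by (simp add: sum_nonneg)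
  then show "energy dx' dy' v' \<gamma>x' \<gamma>y' \<gamma>z' (Suc (Suc k)) \<le> energy dx' dy' v' \<gamma>x' \<gamma>y' \<gamma>z' (Suc k)"
    using energy_descent[OF assms, of k] increment_nonneg[of "Suc k"] by linarith
qed

lemma descent_terms_tendsto_0:
  assumes "kkt dx' dy' u' v' \<gamma>x' \<gamma>y' \<gamma>z'"
  shows "(\<lambda>k. increment (Suc k) + 2 * (\<Sum>j<N. (u (Suc (Suc k)) $ j - u' $ j)\<^sup>2)) \<longlonglongrightarrow> 0"
proof (rule descent_imp_tendsto_0)
  show "energy dx' dy' v' \<gamma>x' \<gamma>y' \<gamma>z' (Suc (Suc k))
      + (increment (Suc k) + 2 * (\<Sum>j<N. (u (Suc (Suc k)) $ j - u' $ j)\<^sup>2))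
    \<le> energy dx' dy' v' \<gamma>x' \<gamma>y' \<gamma>z' (Suc k)" for k
    by (rule energy_descent[OF assms])
  show "0 \<le> energy dx' dy' v' \<gamma>x' \<gamma>y' \<gamma>z' (Suc k)" for k
    by (rule energy_nonneg)
  show "0 \<le> increment (Suc k) + 2 * (\<Sum>j<N. (u (Suc (Suc k)) $ j - u' $ j)\<^sup>2)" for k
    using increment_nonneg[of "Suc k"] by (simp add: sum_nonneg)
qed

section \<open>Convergence of the primal variables\<close>

text \<open>The squared error of \<open>u\<close> is itself one of the vanishing descent terms, so
  convergence holds although the energy from this KKT point need not tend to 0.\<close>

lemma u_tendsto:
  assumes kkt: "kkt dx' dy' u' v' \<gamma>x' \<gamma>y' \<gamma>z'" and j: "j < N"
  shows "(\<lambda>k. u k $ j) \<longlonglongrightarrow> u' $ j"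
proof -
  have "(\<lambda>k. u (Suc (Suc k)) $ j - u' $ j) \<longlonglongrightarrow> 0"
  proof (rule tendsto_0_of_square_le[OF _ _ descent_terms_tendsto_0[OF kkt]])
    fix k
    have "(u (Suc (Suc k)) $ j - u' $ j)\<^sup>2 \<le> (\<Sum>j<N. (u (Suc (Suc k)) $ j - u' $ j)\<^sup>2)"
      using j by (intro member_le_sum) auto
    then show "2 * (u (Suc (Suc k)) $ j - u' $ j)\<^sup>2
        \<le> increment (Suc k) + 2 * (\<Sum>j<N. (u (Suc (Suc k)) $ j - u' $ j)\<^sup>2)"
      using increment_nonneg[of "Suc k"] by linarith
  qed simp
  then have "(\<lambda>k. u (Suc (Suc k)) $ j) \<longlonglongrightarrow> u' $ j" by (rule LIM_zero_cancel)
  then show ?thesis by (rule LIMSEQ_imp_Suc[OF LIMSEQ_imp_Suc])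
qed

lemma increment_tendsto_0: "(\<lambda>k. increment (Suc k)) \<longlonglongrightarrow> 0"
proof -
  obtain dx' dy' u' v' \<gamma>x' \<gamma>y' \<gamma>z' where "kkt dx' dy' u' v' \<gamma>x' \<gamma>y' \<gamma>z'" using kkt_exists by blast
  from descent_terms_tendsto_0[OF this] show ?thesis
    by (rule real_tendsto_sandwich[OF _ _ tendsto_const, rotated 2])
      (auto intro!: always_eventually simp: increment_nonneg sum_nonneg)
qed

text \<open>Multiplied by \<open>\<mu>1\<close> or \<open>\<mu>2\<close>, these increments are the
  constraint residuals: the iterates become feasible in the limit.\<close>

lemma multiplier_increment_tendsto_0:
  shows "i < M \<Longrightarrow> (\<lambda>k. \<gamma>x (Suc k) $ i - \<gamma>x k $ i) \<longlonglongrightarrow> 0"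
    and "i < M \<Longrightarrow> (\<lambda>k. \<gamma>y (Suc k) $ i - \<gamma>y k $ i) \<longlonglongrightarrow> 0"
    and "j < N \<Longrightarrow> (\<lambda>k. \<gamma>z (Suc k) $ j - \<gamma>z k $ j) \<longlonglongrightarrow> 0"
proof -
  show "(\<lambda>k. \<gamma>x (Suc k) $ i - \<gamma>x k $ i) \<longlonglongrightarrow> 0" if "i < M"
    by (rule LIMSEQ_imp_Suc, rule tendsto_0_of_square_le[OF \<mu>(1) _ increment_tendsto_0],
        unfold increment_def, rule admm_energy_ge(1)[OF \<mu> that])
  show "(\<lambda>k. \<gamma>y (Suc k) $ i - \<gamma>y k $ i) \<longlonglongrightarrow> 0" if "i < M"
    by (rule LIMSEQ_imp_Suc, rule tendsto_0_of_square_le[OF \<mu>(1) _ increment_tendsto_0],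
        unfold increment_def, rule admm_energy_ge(2)[OF \<mu> that])
  show "(\<lambda>k. \<gamma>z (Suc k) $ j - \<gamma>z k $ j) \<longlonglongrightarrow> 0" if "j < N"
    by (rule LIMSEQ_imp_Suc, rule tendsto_0_of_square_le[OF \<mu>(2) _ increment_tendsto_0],
        unfold increment_def, rule admm_energy_ge(3)[OF \<mu> that])
qed

text \<open>The multiplier updates express \<open>v\<close>, \<open>dx\<close> and \<open>dy\<close>
  as \<open>P u\<close>, \<open>D u\<close> and \<open>D v\<close> minus vanishing residuals;
  \<open>v\<close> must therefore be treated before \<open>dy\<close>.\<close>

lemma primal_tendsto:
  assumes kkt: "kkt dx' dy' u' v' \<gamma>x' \<gamma>y' \<gamma>z'"
  shows "i < M \<Longrightarrow> (\<lambda>k. (D *\<^sub>v u k) $ i) \<longlonglongrightarrow> dx' $ i"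
    and "j < N \<Longrightarrow> (\<lambda>k. (P *\<^sub>v u k) $ j) \<longlonglongrightarrow> v' $ j"
    and "j < N \<Longrightarrow> (\<lambda>k. v (Suc k) $ j) \<longlonglongrightarrow> v' $ j"
    and "i < M \<Longrightarrow> (\<lambda>k. dx (Suc k) $ i) \<longlonglongrightarrow> dx' $ i"
    and "i < M \<Longrightarrow> (\<lambda>k. dy k $ i) \<longlonglongrightarrow> dy' $ i"
proof -
  have eqs: "dx' = D *\<^sub>v u'" "v' = P *\<^sub>v u'" "dy' = D *\<^sub>v v'"
    using kkt unfolding kkt_def by blast+
  note c' = kkt_carrier[OF kkt]
  show Du: "(\<lambda>k. (D *\<^sub>v u k) $ i) \<longlonglongrightarrow> dx' $ i" if "i < M" for i
    unfolding eqs by (rule tendsto_mult_mat_vec[OF D u_carrier c'(3) u_tendsto[OF kkt] that])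
  show Pu: "(\<lambda>k. (P *\<^sub>v u k) $ j) \<longlonglongrightarrow> v' $ j" if "j < N" for j
    unfolding eqs by (rule tendsto_mult_mat_vec[OF P u_carrier c'(3) u_tendsto[OF kkt] that])
  show v: "(\<lambda>k. v (Suc k) $ j) \<longlonglongrightarrow> v' $ j" if j: "j < N" for j
  proof -
    have "(\<lambda>k. (P *\<^sub>v u (Suc k)) $ j - \<mu>2 * (\<gamma>z (Suc k) $ j - \<gamma>z k $ j)) \<longlonglongrightarrow> v' $ j - \<mu>2 * 0"
      by (intro tendsto_intros LIMSEQ_Suc[OF Pu[OF j]] multiplier_increment_tendsto_0 j)
    then show ?thesis using \<mu> by (simp add: \<gamma>z_index[OF j] del: index_mult_mat_vec)
  qed
  show "(\<lambda>k. dx (Suc k) $ i) \<longlonglongrightarrow> dx' $ i" if i: "i < M"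
  proof -
    have "(\<lambda>k. (D *\<^sub>v u (Suc k)) $ i - \<mu>1 * (\<gamma>x (Suc k) $ i - \<gamma>x k $ i)) \<longlonglongrightarrow> dx' $ i - \<mu>1 * 0"
      by (intro tendsto_intros LIMSEQ_Suc[OF Du[OF i]] multiplier_increment_tendsto_0 i)
    then show ?thesis using \<mu> by (simp add: \<gamma>x_index[OF i] del: index_mult_mat_vec)
  qed
  show "(\<lambda>k. dy k $ i) \<longlonglongrightarrow> dy' $ i" if i: "i < M"
  proof (rule LIMSEQ_imp_Suc)
    have "(\<lambda>k. (D *\<^sub>v v (Suc k)) $ i) \<longlonglongrightarrow> dy' $ i"
      unfolding eqs(3) by (rule tendsto_mult_mat_vec[OF D v_step(1) c'(4) v i])
    then have "(\<lambda>k. (D *\<^sub>v v (Suc k)) $ i - \<mu>1 * (\<gamma>y (Suc k) $ i - \<gamma>y k $ i)) \<longlonglongrightarrow> dy' $ i - \<mu>1 * 0"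
      by (intro tendsto_intros multiplier_increment_tendsto_0 i)
    then show "(\<lambda>k. dy (Suc k) $ i) \<longlonglongrightarrow> dy' $ i"
      using \<mu> by (simp add: \<gamma>y_index[OF i] del: index_mult_mat_vec)
  qed
qed

section \<open>Boundedness and convergence of the multipliers\<close>

lemma multipliers_Bseq:
  shows "i < M \<Longrightarrow> Bseq (\<lambda>k. \<gamma>x (Suc k) $ i)"
    and "i < M \<Longrightarrow> Bseq (\<lambda>k. \<gamma>y (Suc k) $ i)"
    and "j < N \<Longrightarrow> Bseq (\<lambda>k. \<gamma>z (Suc k) $ j)"
proof -
  obtain dx' dy' u' v' \<gamma>x' \<gamma>y' \<gamma>z' where kkt: "kkt dx' dy' u' v' \<gamma>x' \<gamma>y' \<gamma>z'" using kkt_exists by blast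
  let ?V = "\<lambda>k. energy dx' dy' v' \<gamma>x' \<gamma>y' \<gamma>z' (Suc k)"
  have V: "?V k \<le> ?V 0" for k
    using decseqD[OF decseq_energy[OF kkt], of 0 k] by simp
  have bdd: "Bseq x" if c: "c > 0" and le: "\<And>k. c * (x k - l)\<^sup>2 \<le> ?V k" for c l and x :: "nat \<Rightarrow> real"
  proof (rule BseqI')
    fix k
    have "(x k - l)\<^sup>2 \<le> ?V 0 / c"
      using c order_trans[OF le[of k] V[of k]] by (simp add: field_simps)
    then have "\<bar>x k - l\<bar> \<le> sqrt (?V 0 / c)"
      using real_sqrt_le_mono by fastforce
    then show "norm (x k) \<le> sqrt (?V 0 / c) + \<bar>l\<bar>" by simp
  qed
  show "Bseq (\<lambda>k. \<gamma>x (Suc k) $ i)" if "i < M"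
    by (rule bdd[OF \<mu>(1)], unfold energy_def, rule admm_energy_ge(1)[OF \<mu> that])
  show "Bseq (\<lambda>k. \<gamma>y (Suc k) $ i)" if "i < M"
    by (rule bdd[OF \<mu>(1)], unfold energy_def, rule admm_energy_ge(2)[OF \<mu> that])
  show "Bseq (\<lambda>k. \<gamma>z (Suc k) $ j)" if "j < N"
    by (rule bdd[OF \<mu>(2)], unfold energy_def, rule admm_energy_ge(3)[OF \<mu> that])
qed

text \<open>All optimality conditions of the iterates are closed under limits. The primal variables
  converge along the whole sequence, so the correction terms between indices \<open>r k\<close> and
  \<open>Suc (r k)\<close> vanish even if \<open>r\<close> skips indices.\<close>

lemma kkt_of_multiplier_limit:
  assumes kkt: "kkt dx' dy' u' v' \<gamma>x' \<gamma>y' \<gamma>z'" and r: "strict_mono r"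
    and g: "gx \<in> carrier_vec M" "gy \<in> carrier_vec M" "gz \<in> carrier_vec N"
    and gx: "\<And>i. i < M \<Longrightarrow> (\<lambda>k. \<gamma>x (Suc (r k)) $ i) \<longlonglongrightarrow> gx $ i"
    and gy: "\<And>i. i < M \<Longrightarrow> (\<lambda>k. \<gamma>y (Suc (r k)) $ i) \<longlonglongrightarrow> gy $ i"
    and gz: "\<And>j. j < N \<Longrightarrow> (\<lambda>k. \<gamma>z (Suc (r k)) $ j) \<longlonglongrightarrow> gz $ j"
  shows "kkt dx' dy' u' v' gx gy gz"
proof -
  note c' = kkt_carrier[OF kkt]
  have sub: "(\<lambda>k. f (r k)) \<longlonglongrightarrow> l" if "f \<longlonglongrightarrow> l" for f :: "nat \<Rightarrow> real" and l
    using LIMSEQ_subseq_LIMSEQ[OF that r] by (simp add: o_def)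
  have sx: "abs_subgradient lam (gx $ i) (dx' $ i)" if i: "i < M" for i
  proof (rule abs_subgradient_lim[OF dx_subgradient[OF i]])
    have "(\<lambda>k. \<gamma>x (Suc (r k)) $ i + ((D *\<^sub>v u (r k)) $ i - (D *\<^sub>v u (Suc (r k))) $ i) / \<mu>1)
        \<longlonglongrightarrow> gx $ i + (dx' $ i - dx' $ i) / \<mu>1"
      using \<mu> by (intro tendsto_intros gx[OF i] sub[OF primal_tendsto(1)[OF kkt i]]
          sub[OF LIMSEQ_Suc[OF primal_tendsto(1)[OF kkt i]]]) auto
    then show "(\<lambda>k. \<gamma>x (Suc (r k)) $ i + ((D *\<^sub>v u (r k)) $ i - (D *\<^sub>v u (Suc (r k))) $ i) / \<mu>1)
        \<longlonglongrightarrow> gx $ i" by (simp del: index_mult_mat_vec)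
    show "(\<lambda>k. dx (Suc (r k)) $ i) \<longlonglongrightarrow> dx' $ i"
      by (rule sub[OF primal_tendsto(4)[OF kkt i]])
  qed
  have sy: "abs_subgradient lam (gy $ i) (dy' $ i)" if i: "i < M" for i
    by (rule abs_subgradient_lim[OF dy_subgradient[OF i] gy[OF i]
        sub[OF LIMSEQ_Suc[OF primal_tendsto(5)[OF kkt i]]]])
  have st: "u' $ j + (D\<^sup>T *\<^sub>v gx) $ j + (P\<^sup>T *\<^sub>v gz) $ j = b $ j" if j: "j < N" for j
  proof -
    have "(\<lambda>k. u (Suc (r k)) $ j + (D\<^sup>T *\<^sub>v \<gamma>x (Suc (r k))) $ j + (P\<^sup>T *\<^sub>v \<gamma>z (Suc (r k))) $ j)
        \<longlonglongrightarrow> u' $ j + (D\<^sup>T *\<^sub>v gx) $ j + (P\<^sup>T *\<^sub>v gz) $ j"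
      by (intro tendsto_add sub[OF LIMSEQ_Suc[OF u_tendsto[OF kkt j]]]
          tendsto_mult_mat_vec[OF DT _ g(1) gx j] tendsto_mult_mat_vec[OF PT _ g(3) gz j] carriers)
    \<comment> \<open>By \<open>u_stationary\<close> this sequence is constantly
      \<open>b $ j\<close>.\<close>
    then show ?thesis unfolding u_stationary[OF j] using LIMSEQ_unique tendsto_const by blast
  qed
  have sz: "gz = D\<^sup>T *\<^sub>v gy"
  proof (rule eq_vecI)
    fix j assume "j < dim_vec (D\<^sup>T *\<^sub>v gy)"
    then have j: "j < N" using D by simp
    have Tdy: "(\<lambda>k. (D\<^sup>T *\<^sub>v dy k) $ j) \<longlonglongrightarrow> (D\<^sup>T *\<^sub>v dy') $ j"
      by (rule tendsto_mult_mat_vec[OF DT dy_carrier c'(2) primal_tendsto(5)[OF kkt] j])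
    note Pu = primal_tendsto(2)[OF kkt j]
    have l: "(\<lambda>k. (D\<^sup>T *\<^sub>v \<gamma>y (Suc (r k))) $ j
          + ((D\<^sup>T *\<^sub>v dy (Suc (r k))) $ j - (D\<^sup>T *\<^sub>v dy (r k)) $ j) / \<mu>1)
        \<longlonglongrightarrow> (D\<^sup>T *\<^sub>v gy) $ j + ((D\<^sup>T *\<^sub>v dy') $ j - (D\<^sup>T *\<^sub>v dy') $ j) / \<mu>1"
      using \<mu> by (intro tendsto_add tendsto_divide tendsto_diff tendsto_const
          sub[OF LIMSEQ_Suc[OF Tdy]] sub[OF Tdy] tendsto_mult_mat_vec[OF DT _ g(2) gy j] carriers) auto
    have "(\<lambda>k. \<gamma>z (Suc (r k)) $ j + ((P *\<^sub>v u (r k)) $ j - (P *\<^sub>v u (Suc (r k))) $ j) / \<mu>2)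
        \<longlonglongrightarrow> gz $ j + (v' $ j - v' $ j) / \<mu>2"
      using \<mu> by (intro tendsto_add tendsto_divide tendsto_diff tendsto_const
          gz[OF j] sub[OF Pu] sub[OF LIMSEQ_Suc[OF Pu]]) auto
    \<comment> \<open>\<open>v_stationary\<close> identifies the two sequences term by term, so
      their limits agree.\<close>
    from LIMSEQ_unique[OF this l[unfolded v_stationary[OF j]]]
    show "gz $ j = (D\<^sup>T *\<^sub>v gy) $ j" by (simp del: index_mult_mat_vec)
  qed (use D g in simp)
  show ?thesis
    using kkt g sx sy st sz unfolding kkt_def by blast
qed

lemma multipliers_converge:
  assumes kkt: "kkt dx' dy' u' v' \<gamma>x' \<gamma>y' \<gamma>z'"
  shows "\<exists>gx gy gz. kkt dx' dy' u' v' gx gy gz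
    \<and> (\<forall>i<M. (\<lambda>k. \<gamma>x (Suc k) $ i) \<longlonglongrightarrow> gx $ i)
    \<and> (\<forall>i<M. (\<lambda>k. \<gamma>y (Suc k) $ i) \<longlonglongrightarrow> gy $ i)
    \<and> (\<forall>j<N. (\<lambda>k. \<gamma>z (Suc k) $ j) \<longlonglongrightarrow> gz $ j)"
proof -
  \<comment> \<open>All three multipliers are pooled into one finite family so that a single
    subsequence serves them all.\<close>
  define X where "X k = case_sum (\<lambda>i. \<gamma>x (Suc k) $ i)
    (case_sum (\<lambda>i. \<gamma>y (Suc k) $ i) (\<lambda>j. \<gamma>z (Suc k) $ j))" for k
  let ?I = "{..<M} <+> ({..<M} <+> {..<N})"
  have "Bseq (\<lambda>k. X k i)" if "i \<in> ?I" for i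
    using that multipliers_Bseq by (auto simp: X_def)
  from finite_bounded_imp_convergent_subseq[of ?I X, OF _ this]
  obtain r :: "nat \<Rightarrow> nat" and L where r: "strict_mono r"
    and L: "\<forall>i\<in>?I. (\<lambda>k. X (r k) i) \<longlonglongrightarrow> L i"
    by auto
  define gx where "gx = vec M (\<lambda>i. L (Inl i))"
  define gy where "gy = vec M (\<lambda>i. L (Inr (Inl i)))"
  define gz where "gz = vec N (\<lambda>j. L (Inr (Inr j)))"
  have gx: "(\<lambda>k. \<gamma>x (Suc (r k)) $ i) \<longlonglongrightarrow> gx $ i" if "i < M" for i
    using bspec[OF L, of "Inl i"] that by (simp add: X_def gx_def InlI)
  have gy: "(\<lambda>k. \<gamma>y (Suc (r k)) $ i) \<longlonglongrightarrow> gy $ i" if "i < M" for i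
    using bspec[OF L, of "Inr (Inl i)"] that by (simp add: X_def gy_def InlI InrI)
  have gz: "(\<lambda>k. \<gamma>z (Suc (r k)) $ j) \<longlonglongrightarrow> gz $ j" if "j < N" for j
    using bspec[OF L, of "Inr (Inr j)"] that by (simp add: X_def gz_def InrI)
  have kkt': "kkt dx' dy' u' v' gx gy gz"
    by (rule kkt_of_multiplier_limit[OF kkt r _ _ _ gx gy gz]) (simp_all add: gx_def gy_def gz_def)
  let ?V = "\<lambda>k. energy dx' dy' v' gx gy gz (Suc k)"
  have sub: "(\<lambda>k. f (Suc (r k))) \<longlonglongrightarrow> l" if "f \<longlonglongrightarrow> l" for f :: "nat \<Rightarrow> real" and l
    using LIMSEQ_subseq_LIMSEQ[OF LIMSEQ_Suc[OF that] r] by (simp add: o_def)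
  \<comment> \<open>Along \<open>r\<close> the multiplier errors vanish by choice of the cluster
    point, the primal errors by convergence of the whole sequences.\<close>
  have "(\<lambda>k. ?V (r k)) \<longlonglongrightarrow> 0"
    unfolding energy_def
    by (rule tendsto_admm_energy[OF _ _ _ _ _ _ \<mu>]; rule LIM_zero;
        rule gx gy gz sub[OF primal_tendsto(1)[OF kkt]] sub[OF primal_tendsto(2)[OF kkt]]
          sub[OF primal_tendsto(5)[OF kkt]]; assumption)
  then have V: "?V \<longlonglongrightarrow> 0"
    by (rule decseq_subseq_tendsto_0[OF decseq_energy[OF kkt'] energy_nonneg r])
  have "(\<lambda>k. \<gamma>x (Suc k) $ i) \<longlonglongrightarrow> gx $ i" if "i < M" for i
    by (rule LIM_zero_cancel, rule tendsto_0_of_square_le[OF \<mu>(1) _ V], unfold energy_def,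
        rule admm_energy_ge(1)[OF \<mu> that])
  moreover have "(\<lambda>k. \<gamma>y (Suc k) $ i) \<longlonglongrightarrow> gy $ i" if "i < M" for i
    by (rule LIM_zero_cancel, rule tendsto_0_of_square_le[OF \<mu>(1) _ V], unfold energy_def,
        rule admm_energy_ge(2)[OF \<mu> that])
  moreover have "(\<lambda>k. \<gamma>z (Suc k) $ j) \<longlonglongrightarrow> gz $ j" if "j < N" for j
    by (rule LIM_zero_cancel, rule tendsto_0_of_square_le[OF \<mu>(2) _ V], unfold energy_def,
        rule admm_energy_ge(3)[OF \<mu> that])
  ultimately show ?thesis using kkt' by blast
qed

lemma converges_to_kkt:
  "\<exists>dx' dy' u' v' \<gamma>x' \<gamma>y' \<gamma>z'. kkt dx' dy' u' v' \<gamma>x' \<gamma>y' \<gamma>z' \<and>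
     vec_converges M (\<lambda>k. dx (Suc k)) dx' \<and> vec_converges M (\<lambda>k. dy (Suc k)) dy' \<and>
     vec_converges N (\<lambda>k. u (Suc k)) u' \<and> vec_converges N (\<lambda>k. v (Suc k)) v' \<and>
     vec_converges M (\<lambda>k. \<gamma>x (Suc k)) \<gamma>x' \<and> vec_converges M (\<lambda>k. \<gamma>y (Suc k)) \<gamma>y' \<and>
     vec_converges N (\<lambda>k. \<gamma>z (Suc k)) \<gamma>z'"
proof -
  \<comment> \<open>Only the primal part of this KKT point is kept; its multipliers are replaced by
    the limits of the iterates.\<close>
  obtain dx' dy' u' v' gx0 gy0 gz0 where "kkt dx' dy' u' v' gx0 gy0 gz0" using kkt_exists by blast
  from multipliers_converge[OF this] obtain gx gy gz where kkt: "kkt dx' dy' u' v' gx gy gz"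
    and gx: "\<And>i. i < M \<Longrightarrow> (\<lambda>k. \<gamma>x (Suc k) $ i) \<longlonglongrightarrow> gx $ i"
    and gy: "\<And>i. i < M \<Longrightarrow> (\<lambda>k. \<gamma>y (Suc k) $ i) \<longlonglongrightarrow> gy $ i"
    and gz: "\<And>j. j < N \<Longrightarrow> (\<lambda>k. \<gamma>z (Suc k) $ j) \<longlonglongrightarrow> gz $ j"
    by blast
  note c' = kkt_carrier[OF kkt]
  have "vec_converges M (\<lambda>k. dx (Suc k)) dx'" "vec_converges M (\<lambda>k. dy (Suc k)) dy'"
    "vec_converges N (\<lambda>k. u (Suc k)) u'" "vec_converges N (\<lambda>k. v (Suc k)) v'"
    "vec_converges M (\<lambda>k. \<gamma>x (Suc k)) gx" "vec_converges M (\<lambda>k. \<gamma>y (Suc k)) gy"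
    "vec_converges N (\<lambda>k. \<gamma>z (Suc k)) gz"
    by (rule vec_convergesI; (rule carriers | rule c' | rule gx gy gz primal_tendsto(3,4)[OF kkt]
      LIMSEQ_Suc[OF primal_tendsto(5)[OF kkt]] LIMSEQ_Suc[OF u_tendsto[OF kkt]]; assumption))+
  with kkt show ?thesis by blast
qed

end

theorem mainTheorem1:
  fixes n :: nat and b :: "real vec" and lam \<mu>1 \<mu>2 :: real
    and D P Av Au :: "real mat"
    and dx dy u v \<gamma>x \<gamma>y \<gamma>z :: "nat \<Rightarrow> real vec"
  assumes "n \<ge> 2" and "b \<in> carrier_vec (n\<^sup>2)" and "lam > 0" and "\<mu>1 > 0" and "\<mu>2 > 0"
    and D: "D = diff_mat n" and P: "P = row_major_mat n"
    and Av: "Av = D\<^sup>T * D + (\<mu>1 / \<mu>2) \<cdot>\<^sub>m 1\<^sub>m (n\<^sup>2)"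
    and Au: "Au = D\<^sup>T * D + (\<mu>1 / \<mu>2 + \<mu>1) \<cdot>\<^sub>m 1\<^sub>m (n\<^sup>2)"
    and init: "u 0 \<in> carrier_vec (n\<^sup>2)" "dy 0 \<in> carrier_vec (n\<^sup>2 - n)"
      "\<gamma>x 0 \<in> carrier_vec (n\<^sup>2 - n)" "\<gamma>y 0 \<in> carrier_vec (n\<^sup>2 - n)"
      "\<gamma>z 0 \<in> carrier_vec (n\<^sup>2)"
    and dx_step: "\<And>k. dx (Suc k) = soft_threshold (D *\<^sub>v u k + \<mu>1 \<cdot>\<^sub>v \<gamma>x k) (lam * \<mu>1)"
    and v_step: "\<And>k. v (Suc k) \<in> carrier_vec (n\<^sup>2)"
      "\<And>k. Av *\<^sub>v v (Suc k) =
         D\<^sup>T *\<^sub>v (dy k - \<mu>1 \<cdot>\<^sub>v \<gamma>y k) + \<mu>1 \<cdot>\<^sub>v \<gamma>z k + (\<mu>1 / \<mu>2) \<cdot>\<^sub>v (P *\<^sub>v u k)"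
    and dy_step: "\<And>k. dy (Suc k) = soft_threshold (D *\<^sub>v v (Suc k) + \<mu>1 \<cdot>\<^sub>v \<gamma>y k) (lam * \<mu>1)"
    and u_step: "\<And>k. u (Suc k) \<in> carrier_vec (n\<^sup>2)"
      "\<And>k. Au *\<^sub>v u (Suc k) =
         \<mu>1 \<cdot>\<^sub>v b + D\<^sup>T *\<^sub>v (dx (Suc k) - \<mu>1 \<cdot>\<^sub>v \<gamma>x k)
         + P\<^sup>T *\<^sub>v ((\<mu>1 / \<mu>2) \<cdot>\<^sub>v v (Suc k) - \<mu>1 \<cdot>\<^sub>v \<gamma>z k)"
    and \<gamma>x_step: "\<And>k. \<gamma>x (Suc k) = \<gamma>x k + (1 / \<mu>1) \<cdot>\<^sub>v (D *\<^sub>v u (Suc k) - dx (Suc k))"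
    and \<gamma>y_step: "\<And>k. \<gamma>y (Suc k) = \<gamma>y k + (1 / \<mu>1) \<cdot>\<^sub>v (D *\<^sub>v v (Suc k) - dy (Suc k))"
    and \<gamma>z_step: "\<And>k. \<gamma>z (Suc k) = \<gamma>z k + (1 / \<mu>2) \<cdot>\<^sub>v (P *\<^sub>v u (Suc k) - v (Suc k))"
  shows "(\<forall>r \<in> carrier_vec (n\<^sup>2). \<exists>!x. x \<in> carrier_vec (n\<^sup>2) \<and> Av *\<^sub>v x = r) \<and>
    (\<forall>r \<in> carrier_vec (n\<^sup>2). \<exists>!x. x \<in> carrier_vec (n\<^sup>2) \<and> Au *\<^sub>v x = r) \<and>
    (\<exists>dx' dy' u' v' \<gamma>x' \<gamma>y' \<gamma>z'.
       tv_primal_dual_optimal n lam b dx' dy' u' v' \<gamma>x' \<gamma>y' \<gamma>z' \<and>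
       vec_converges (n\<^sup>2 - n) (\<lambda>k. dx (Suc k)) dx' \<and>
       vec_converges (n\<^sup>2 - n) (\<lambda>k. dy (Suc k)) dy' \<and>
       vec_converges (n\<^sup>2) (\<lambda>k. u (Suc k)) u' \<and>
       vec_converges (n\<^sup>2) (\<lambda>k. v (Suc k)) v' \<and>
       vec_converges (n\<^sup>2 - n) (\<lambda>k. \<gamma>x (Suc k)) \<gamma>x' \<and>
       vec_converges (n\<^sup>2 - n) (\<lambda>k. \<gamma>y (Suc k)) \<gamma>y' \<and>
       vec_converges (n\<^sup>2) (\<lambda>k. \<gamma>z (Suc k)) \<gamma>z')"
proof (intro conjI ballI)
  note D_carrier = diff_mat_carrier[of n, folded D]
    and P_carrier = row_major_mat_carrier[of n, folded P]
    and P_orthogonal = row_major_mat_orthogonal[of n, folded P]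
    and primal_dual = kkt_imp_primal_dual_optimal[OF assms(2,3), folded D P]
  show "\<exists>!x. x \<in> carrier_vec (n\<^sup>2) \<and> Av *\<^sub>v x = r" if "r \<in> carrier_vec (n\<^sup>2)" for r
    by (rule transpose_gram_plus_scaled_one_ex1[OF D_carrier _ Av that]) (use assms(4,5) in simp)
  show "\<exists>!x. x \<in> carrier_vec (n\<^sup>2) \<and> Au *\<^sub>v x = r" if "r \<in> carrier_vec (n\<^sup>2)" for r
    by (rule transpose_gram_plus_scaled_one_ex1[OF D_carrier _ Au that])
      (use assms(4,5) in \<open>simp add: add_pos_pos\<close>)
  interpret admm "n\<^sup>2 - n" "n\<^sup>2" D P b lam \<mu>1 \<mu>2 dx dy u v \<gamma>x \<gamma>y \<gamma>z
    by unfold_locales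
      (fact D_carrier P_carrier P_orthogonal assms(2-5) init dx_step v_step[unfolded Av] dy_step u_step[unfolded Au]
        \<gamma>x_step \<gamma>y_step \<gamma>z_step)+
  show "\<exists>dx' dy' u' v' \<gamma>x' \<gamma>y' \<gamma>z'.
       tv_primal_dual_optimal n lam b dx' dy' u' v' \<gamma>x' \<gamma>y' \<gamma>z' \<and>
       vec_converges (n\<^sup>2 - n) (\<lambda>k. dx (Suc k)) dx' \<and>
       vec_converges (n\<^sup>2 - n) (\<lambda>k. dy (Suc k)) dy' \<and>
       vec_converges (n\<^sup>2) (\<lambda>k. u (Suc k)) u' \<and>
       vec_converges (n\<^sup>2) (\<lambda>k. v (Suc k)) v' \<and>
       vec_converges (n\<^sup>2 - n) (\<lambda>k. \<gamma>x (Suc k)) \<gamma>x' \<and>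
       vec_converges (n\<^sup>2 - n) (\<lambda>k. \<gamma>y (Suc k)) \<gamma>y' \<and>
       vec_converges (n\<^sup>2) (\<lambda>k. \<gamma>z (Suc k)) \<gamma>z'"
    using converges_to_kkt primal_dual by blast
qed

end
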